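(* Let $\varepsilon,\delta\in[0,1]$, let $m\ge1$ be an integer, let $\eta\geq 0$, and let $G'=(M\circ G\circ P)$ be a concatenated game with inner game $G=(X\times Y,A\times B,\mu,V)$; write $|\Sigma_G|=|A|\cdot|B|$. (Classical) If $G'$ is $(\varepsilon,\delta)$-weakly fortified against classical substrategies and $\delta\cdot(m-1)\cdot|\Sigma_G|^{m-1}\le\eta$, then $$\mathrm{Val}({G'}^{\otimes m})\le(\mathrm{Val}(G)+\varepsilon)^m+\eta .$$ (Quantum) If $G'$ is $(\varepsilon,\delta)$-weakly fortified against entangled substrategies and $\delta\cdot(m-1)\cdot|\Sigma_G|^{m-1}\le\eta$, then $$\mathrm{Val}^*({G'}^{\otimes m})\le(\mathrm{Val}^*(G)+\varepsilon)^m+\eta .$$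
   Context: Games. A two-player game $G=(X\times Y,A\times B,\mu,V)$ consists of finite question sets $X,Y$, finite answer sets $A,B$, a probability distribution $\mu$ on $X\times Y$, and a predicate $V:A\times B\times X\times Y\to\{0,1\}$. Substrategies and values. A classical substrategy assigns to each question $q$ of the first player and $q'$ of the second nonnegative numbers $f(q,a)$, $g(q',b)$ indexed by the possible answers, with $f(q):=\sum_af(q,a)\le1$, $g(q'):=\sum_bg(q',b)\le1$. An entangled substrategy consists of an integer $d$, a unit vector $|\psi\rangle\in\mathbb C^d\otimes\mathbb C^d$ and positive semidefinite $d\times d$ matrices $A_q^a$, $B_{q'}^b$ with $A_q:=\sum_aA_q^a\le\mathrm{Id}$, $B_{q'}:=\sum_bB_{q'}^b\le\mathrm{Id}$. They are complete strategies if all these inequalities are equalities. The value of a substrategy in a game is the expectation over the referee's randomness of the sum, over accepted answer pairs $(a,b)$, of $f(q,a)g(q',b)$ (classical), resp. $\langle\psi|A_q^a\otimes B_{q'}^b|\psi\rangle$ (entangled). $\mathrm{Val}$, resp. $\mathrm{Val}^*$, of a game is the supremum of the value over complete classical, resp. entangled, strategies. Concatenated games. Given bipartite graphs $M,P$ on vertex sets $(X',X)$, $(Y',Y)$ (every $x\in X$, $y\in Y$ having at least one neighbour; $N(\cdot)$ denotes the neighbour set), in $G'=(M\circ G\circ P)$ the referee samples $(x,y)\sim\mu$ and independent uniformly random $x'\sim N(x)$, $y'\sim N(y)$, sends $x'$ and $y'$ to the players, who answer with maps $a':N(x')\to A$, $b':N(y')\to B$, and win iff $V(a'(x),b'(y),x,y)=1$.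 $G$ is called the inner game. A substrategy for $G'$ induces a substrategy for $G$: $f(x,a)=\mathbb E_{x'\sim N(x)}\sum_{a':a'(x)=a}f(x',a')$ and $A_x^a=\mathbb E_{x'\sim N(x)}\sum_{a':a'(x)=a}A_{x'}^{a'}$, and similarly for $g(y,b)$ and $B_y^b$; put $f(x)=\sum_af(x,a)$, $A_x=\sum_aA_x^a$, etc. Weak fortification. $G'$ is $(\varepsilon,\delta)$-weakly fortified against classical substrategies if every classical substrategy $(f,g)$ for $G'$ satisfies $\mathrm{Val}(G',f,g)\le(\mathrm{Val}(G)+\varepsilon)\,\mathbb E_{(x,y)\sim\mu}f(x)g(y)+\delta$. It is $(\varepsilon,\delta)$-weakly fortified against entangled substrategies if every entangled substrategy for $G'$ has value at most $(\mathrm{Val}^*(G)+\varepsilon)\,\mathbb E_{(x,y)\sim\mu}\langle\psi|A_x\otimes B_y|\psi\rangle+\delta$. Parallel repetition. In ${G'}^{\otimes m}$ the referee samples $m$ independent instances $(x_i,y_i,x_i',y_i')$ of $G'$, sends $(x_1',\dots,x_m')$ to the first player and $(y_1',\dots,y_m')$ to the second, receives $(a_1',\dots,a_m')$ and $(b_1',\dots,b_m')$, and accepts iff $\prod_{i=1}^mV(a_i'(x_i),b_i'(y_i),x_i,y_i)=1$. *)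

theory Defs
  imports "HOL-Probability.Product_PMF" "Jordan_Normal_Form.Matrix"
begin

section \<open>Games\<close>

record ('x, 'y, 'a, 'b) game =
  questX :: "'x set"
  questY :: "'y set"
  ansA :: "'a set"
  ansB :: "'b set"
  qdist :: "('x \<times> 'y) pmf"
  accepts :: "'a \<Rightarrow> 'b \<Rightarrow> 'x \<Rightarrow> 'y \<Rightarrow> bool"

definition is_game :: "('x, 'y, 'a, 'b) game \<Rightarrow> bool" where
  "is_game G \<longleftrightarrow> finite (questX G) \<and> finite (questY G) \<and> finite (ansA G) \<and> finite (ansB G) \<and>
     set_pmf (qdist G) \<subseteq> questX G \<times> questY G"

text \<open>
  In a concatenated game the referee's verdict depends on the inner questions, which the players do
  not see, and the admissible answers depend on the question received. All notions of value are
  therefore defined for the following more general structure: \<open>referee\<close> is the distribution of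
  everything the referee samples, and \<open>ask1 r\<close>, \<open>ask2 r\<close> are the questions sent when \<open>r\<close> was sampled.
\<close>

record ('r, 'p, 'q, 'a, 'b) refereed_game =
  referee :: "'r pmf"
  quest1 :: "'p set"
  quest2 :: "'q set"
  ask1 :: "'r \<Rightarrow> 'p"
  ask2 :: "'r \<Rightarrow> 'q"
  ans1 :: "'p \<Rightarrow> 'a set"
  ans2 :: "'q \<Rightarrow> 'b set"
  wins :: "'r \<Rightarrow> 'a \<Rightarrow> 'b \<Rightarrow> bool"

definition plain :: "('x, 'y, 'a, 'b) game \<Rightarrow> ('x \<times> 'y, 'x, 'y, 'a, 'b) refereed_game" where
  "plain G = \<lparr> referee = qdist G, quest1 = questX G, quest2 = questY G,
     ask1 = fst, ask2 = snd, ans1 = (\<lambda>_. ansA G), ans2 = (\<lambda>_. ansB G),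
     wins = (\<lambda>(x, y) a b. accepts G a b x y) \<rparr>"

definition accepted ::
    "('r, 'p, 'q, 'a, 'b) refereed_game \<Rightarrow> 'r \<Rightarrow> ('a \<times> 'b) set" where
  "accepted R r = {(a, b) \<in> ans1 R (ask1 R r) \<times> ans2 R (ask2 R r). wins R r a b}"


section \<open>Classical strategies\<close>

definition classical_sub :: "'p set \<Rightarrow> ('p \<Rightarrow> 'a set) \<Rightarrow> ('p \<Rightarrow> 'a \<Rightarrow> real) \<Rightarrow> bool" where
  "classical_sub Q S f \<longleftrightarrow> (\<forall>q\<in>Q. (\<forall>a\<in>S q. 0 \<le> f q a) \<and> (\<Sum>a\<in>S q. f q a) \<le> 1)"

definition classical_substrategy ::
    "('r, 'p, 'q, 'a, 'b) refereed_game \<Rightarrow> ('p \<Rightarrow> 'a \<Rightarrow> real) \<Rightarrow> ('q \<Rightarrow> 'b \<Rightarrow> real) \<Rightarrow> bool" where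
  "classical_substrategy R f g \<longleftrightarrow>
     classical_sub (quest1 R) (ans1 R) f \<and> classical_sub (quest2 R) (ans2 R) g"

definition classical_strategy ::
    "('r, 'p, 'q, 'a, 'b) refereed_game \<Rightarrow> ('p \<Rightarrow> 'a \<Rightarrow> real) \<Rightarrow> ('q \<Rightarrow> 'b \<Rightarrow> real) \<Rightarrow> bool" where
  "classical_strategy R f g \<longleftrightarrow> classical_substrategy R f g \<and>
     (\<forall>q\<in>quest1 R. (\<Sum>a\<in>ans1 R q. f q a) = 1) \<and>
     (\<forall>q\<in>quest2 R. (\<Sum>b\<in>ans2 R q. g q b) = 1)"

definition classical_value ::
    "('r, 'p, 'q, 'a, 'b) refereed_game \<Rightarrow> ('p \<Rightarrow> 'a \<Rightarrow> real) \<Rightarrow> ('q \<Rightarrow> 'b \<Rightarrow> real) \<Rightarrow> real" where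
  "classical_value R f g = measure_pmf.expectation (referee R)
     (\<lambda>r. \<Sum>(a, b)\<in>accepted R r. f (ask1 R r) a * g (ask2 R r) b)"

text \<open>
  Values of strategies lie in the unit interval; inserting \<open>0\<close> only fixes the supremum over an
  empty set of strategies (a game without answers) to be \<open>0\<close>, as \<open>Sup {}\<close> is unspecified on reals.
\<close>

definition Val :: "('r, 'p, 'q, 'a, 'b) refereed_game \<Rightarrow> real" where
  "Val R = Sup (insert 0 {classical_value R f g | f g. classical_strategy R f g})"


section \<open>Entangled strategies\<close>

definition tensor_mat :: "complex mat \<Rightarrow> complex mat \<Rightarrow> complex mat" where
  "tensor_mat A B = mat (dim_row A * dim_row B) (dim_col A * dim_col B)
     (\<lambda>(i, j). A $$ (i div dim_row B, j div dim_col B) * B $$ (i mod dim_row B, j mod dim_col B))"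

definition mat_sum :: "nat \<Rightarrow> ('i \<Rightarrow> complex mat) \<Rightarrow> 'i set \<Rightarrow> complex mat" where
  "mat_sum d F I = mat d d (\<lambda>(i, j). \<Sum>k\<in>I. F k $$ (i, j))"

text \<open>
  The order on \<^typ>\<open>complex\<close> is such that \<open>0 \<le> z\<close> means that \<open>z\<close> is real and nonnegative; in
  particular the matrices below are Hermitian. The form \<open>\<bullet>c\<close> conjugates its second argument.
\<close>

definition pos_semidef :: "nat \<Rightarrow> complex mat \<Rightarrow> bool" where
  "pos_semidef d A \<longleftrightarrow> A \<in> carrier_mat d d \<and> (\<forall>v\<in>carrier_vec d. 0 \<le> (A *\<^sub>v v) \<bullet>c v)"

definition loewner_le :: "nat \<Rightarrow> complex mat \<Rightarrow> complex mat \<Rightarrow> bool" where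
  "loewner_le d A B \<longleftrightarrow> pos_semidef d (B - A)"

definition quantum_sub ::
    "'p set \<Rightarrow> ('p \<Rightarrow> 'a set) \<Rightarrow> nat \<Rightarrow> ('p \<Rightarrow> 'a \<Rightarrow> complex mat) \<Rightarrow> bool" where
  "quantum_sub Q S d A \<longleftrightarrow> (\<forall>q\<in>Q. (\<forall>a\<in>S q. pos_semidef d (A q a)) \<and>
     loewner_le d (mat_sum d (A q) (S q)) (1\<^sub>m d))"

definition entangled_substrategy ::
    "('r, 'p, 'q, 'a, 'b) refereed_game \<Rightarrow> nat \<Rightarrow> complex vec \<Rightarrow>
     ('p \<Rightarrow> 'a \<Rightarrow> complex mat) \<Rightarrow> ('q \<Rightarrow> 'b \<Rightarrow> complex mat) \<Rightarrow> bool" where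
  "entangled_substrategy R d \<psi> A B \<longleftrightarrow>
     \<psi> \<in> carrier_vec (d * d) \<and> \<psi> \<bullet>c \<psi> = 1 \<and>
     quantum_sub (quest1 R) (ans1 R) d A \<and> quantum_sub (quest2 R) (ans2 R) d B"

definition entangled_strategy ::
    "('r, 'p, 'q, 'a, 'b) refereed_game \<Rightarrow> nat \<Rightarrow> complex vec \<Rightarrow>
     ('p \<Rightarrow> 'a \<Rightarrow> complex mat) \<Rightarrow> ('q \<Rightarrow> 'b \<Rightarrow> complex mat) \<Rightarrow> bool" where
  "entangled_strategy R d \<psi> A B \<longleftrightarrow> entangled_substrategy R d \<psi> A B \<and>
     (\<forall>q\<in>quest1 R. mat_sum d (A q) (ans1 R q) = 1\<^sub>m d) \<and>
     (\<forall>q\<in>quest2 R. mat_sum d (B q) (ans2 R q) = 1\<^sub>m d)"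

text \<open>
  \<open>\<langle>\<psi>| A \<otimes> B |\<psi>\<rangle>\<close>. It is real and nonnegative for positive semidefinite \<open>A\<close>, \<open>B\<close>; \<^const>\<open>Re\<close>
  merely casts it to type \<^typ>\<open>real\<close>.
\<close>

definition tensor_expect :: "complex vec \<Rightarrow> complex mat \<Rightarrow> complex mat \<Rightarrow> real" where
  "tensor_expect \<psi> A B = Re ((tensor_mat A B *\<^sub>v \<psi>) \<bullet>c \<psi>)"

definition entangled_value ::
    "('r, 'p, 'q, 'a, 'b) refereed_game \<Rightarrow> complex vec \<Rightarrow>
     ('p \<Rightarrow> 'a \<Rightarrow> complex mat) \<Rightarrow> ('q \<Rightarrow> 'b \<Rightarrow> complex mat) \<Rightarrow> real" where
  "entangled_value R \<psi> A B = measure_pmf.expectation (referee R)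
     (\<lambda>r. \<Sum>(a, b)\<in>accepted R r. tensor_expect \<psi> (A (ask1 R r) a) (B (ask2 R r) b))"

definition Val_star :: "('r, 'p, 'q, 'a, 'b) refereed_game \<Rightarrow> real" where
  "Val_star R =
     Sup (insert 0 {entangled_value R \<psi> A B | d \<psi> A B. entangled_strategy R d \<psi> A B})"


section \<open>Concatenated games\<close>

text \<open>
  A bipartite graph on \<open>(X', X)\<close> is given by its set of edges \<open>E \<subseteq> X' \<times> X\<close>. Thus \<open>E\<inverse> `` {x}\<close> is the
  neighbourhood of \<open>x \<in> X\<close> and \<open>E `` {x'}\<close> the neighbourhood of \<open>x' \<in> X'\<close>.
\<close>

definition is_bipartite_graph :: "('x1 \<times> 'x) set \<Rightarrow> 'x1 set \<Rightarrow> 'x set \<Rightarrow> bool" where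
  "is_bipartite_graph E X' X \<longleftrightarrow> finite X' \<and> finite X \<and> E \<subseteq> X' \<times> X \<and> (\<forall>x\<in>X. E\<inverse> `` {x} \<noteq> {})"

text \<open>
  A map \<open>N(x') \<rightarrow> A\<close> is represented by its extension by \<open>undefined\<close> outside \<open>N(x')\<close>, as usual for
  \<^const>\<open>PiE\<close>.
\<close>

definition concat_game ::
    "'x1 set \<Rightarrow> ('x1 \<times> 'x) set \<Rightarrow> ('x, 'y, 'a, 'b) game \<Rightarrow> 'y1 set \<Rightarrow> ('y1 \<times> 'y) set \<Rightarrow>
     ('x \<times> 'y \<times> 'x1 \<times> 'y1, 'x1, 'y1, 'x \<Rightarrow> 'a, 'y \<Rightarrow> 'b) refereed_game" where
  "concat_game X' M G Y' P = \<lparr>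
     referee = do {
       (x, y) \<leftarrow> qdist G;
       x' \<leftarrow> pmf_of_set (M\<inverse> `` {x});
       y' \<leftarrow> pmf_of_set (P\<inverse> `` {y});
       return_pmf (x, y, x', y') },
     quest1 = X', quest2 = Y',
     ask1 = (\<lambda>(x, y, x', y'). x'), ask2 = (\<lambda>(x, y, x', y'). y'),
     ans1 = (\<lambda>x'. (M `` {x'}) \<rightarrow>\<^sub>E ansA G), ans2 = (\<lambda>y'. (P `` {y'}) \<rightarrow>\<^sub>E ansB G),
     wins = (\<lambda>(x, y, x', y') a' b'. accepts G (a' x) (b' y) x y) \<rparr>"


section \<open>Weak fortification\<close>

definition induced_classical ::
    "('x1 \<times> 'x) set \<Rightarrow> 'a set \<Rightarrow> ('x1 \<Rightarrow> ('x \<Rightarrow> 'a) \<Rightarrow> real) \<Rightarrow> 'x \<Rightarrow> 'a \<Rightarrow> real" where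
  "induced_classical E S f x a = measure_pmf.expectation (pmf_of_set (E\<inverse> `` {x}))
     (\<lambda>x'. \<Sum>a' | a' \<in> (E `` {x'}) \<rightarrow>\<^sub>E S \<and> a' x = a. f x' a')"

definition induced_quantum ::
    "('x1 \<times> 'x) set \<Rightarrow> 'a set \<Rightarrow> nat \<Rightarrow> ('x1 \<Rightarrow> ('x \<Rightarrow> 'a) \<Rightarrow> complex mat) \<Rightarrow>
     'x \<Rightarrow> 'a \<Rightarrow> complex mat" where
  "induced_quantum E S d A x a = (1 / of_nat (card (E\<inverse> `` {x}))) \<cdot>\<^sub>m
     mat_sum d (\<lambda>x'. mat_sum d (A x') {a' \<in> (E `` {x'}) \<rightarrow>\<^sub>E S. a' x = a}) (E\<inverse> `` {x})"

definition weakly_fortified_classical ::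
    "real \<Rightarrow> real \<Rightarrow> 'x1 set \<Rightarrow> ('x1 \<times> 'x) set \<Rightarrow> ('x, 'y, 'a, 'b) game \<Rightarrow>
     'y1 set \<Rightarrow> ('y1 \<times> 'y) set \<Rightarrow> bool" where
  "weakly_fortified_classical \<epsilon> \<delta> X' M G Y' P \<longleftrightarrow>
     (\<forall>f g. classical_substrategy (concat_game X' M G Y' P) f g \<longrightarrow>
        classical_value (concat_game X' M G Y' P) f g \<le>
          (Val (plain G) + \<epsilon>) * measure_pmf.expectation (qdist G)
            (\<lambda>(x, y). (\<Sum>a\<in>ansA G. induced_classical M (ansA G) f x a) *
                      (\<Sum>b\<in>ansB G. induced_classical P (ansB G) g y b)) + \<delta>)"

definition weakly_fortified_entangled ::
    "real \<Rightarrow> real \<Rightarrow> 'x1 set \<Rightarrow> ('x1 \<times> 'x) set \<Rightarrow> ('x, 'y, 'a, 'b) game \<Rightarrow>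
     'y1 set \<Rightarrow> ('y1 \<times> 'y) set \<Rightarrow> bool" where
  "weakly_fortified_entangled \<epsilon> \<delta> X' M G Y' P \<longleftrightarrow>
     (\<forall>d \<psi> A B. entangled_substrategy (concat_game X' M G Y' P) d \<psi> A B \<longrightarrow>
        entangled_value (concat_game X' M G Y' P) \<psi> A B \<le>
          (Val_star (plain G) + \<epsilon>) * measure_pmf.expectation (qdist G)
            (\<lambda>(x, y). tensor_expect \<psi>
               (mat_sum d (induced_quantum M (ansA G) d A x) (ansA G))
               (mat_sum d (induced_quantum P (ansB G) d B y) (ansB G))) + \<delta>)"


section \<open>Parallel repetition\<close>

text \<open>Tuples of length \<open>m\<close> are functions on \<open>{..<m}\<close>, extended by \<open>undefined\<close>.\<close>

definition repeated_game ::
    "nat \<Rightarrow> ('r, 'p, 'q, 'a, 'b) refereed_game \<Rightarrow>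
     (nat \<Rightarrow> 'r, nat \<Rightarrow> 'p, nat \<Rightarrow> 'q, nat \<Rightarrow> 'a, nat \<Rightarrow> 'b) refereed_game" where
  "repeated_game m R = \<lparr>
     referee = Pi_pmf {..<m} undefined (\<lambda>_. referee R),
     quest1 = {..<m} \<rightarrow>\<^sub>E quest1 R, quest2 = {..<m} \<rightarrow>\<^sub>E quest2 R,
     ask1 = (\<lambda>r. \<lambda>i\<in>{..<m}. ask1 R (r i)), ask2 = (\<lambda>r. \<lambda>i\<in>{..<m}. ask2 R (r i)),
     ans1 = (\<lambda>q. \<Pi>\<^sub>E i\<in>{..<m}. ans1 R (q i)), ans2 = (\<lambda>q. \<Pi>\<^sub>E i\<in>{..<m}. ans2 R (q i)),
     wins = (\<lambda>r a b. \<forall>i<m. wins R (r i) (a i) (b i)) \<rparr>"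

end

theory Submission
  imports Defs "HOL-Library.Function_Algebras"
begin

text \<open>
  Write \<open>c = Val(G) + \<epsilon>\<close>. In a strategy for \<open>k + 1\<close> rounds, fix what the referee samples in the first \<open>k\<close>
  rounds together with an accepted tuple of inner answers for these rounds. What is left is a substrategy
  for one round of \<open>G'\<close>, whose value weak fortification bounds by \<open>c\<close> times its mass plus \<open>\<delta>\<close>. There are
  at most \<open>|\<Sigma>|^k\<close> tuples of inner answers, and the masses add up to an average, over the questions in the last
  round, of values of strategies for \<open>k\<close> rounds. Hence \<open>w\<^bsub>k+1\<^esub> \<le> c w\<^bsub>k\<^esub> + \<delta> |\<Sigma>|^k\<close> for the optimal values.
  The recursion starts with \<open>w\<^bsub>1\<^esub> \<le> Val(G)\<close>, since a strategy for \<open>G'\<close> induces one for \<open>G\<close> of the same value.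
\<close>

text \<open>Conditioning is on the inner answers a'(x_i), b'(y_i), not on the full maps a', b'. The
  verdict sees nothing else, and the number of events stays at most |\<Sigma>|^k whatever the
  degrees of the graphs. Nothing is renormalised after conditioning: the remainder is kept as a
  substrategy, so in the quantum case the state \<psi> never changes. Starting at zero rounds, where
  the optimal value may be 1, would cost an extra \<delta>; starting at one round leaves m - 1 error
  terms \<delta> |\<Sigma>|^k with 1 \<le> k \<le> m - 1, each at most \<delta> |\<Sigma>|^(m-1),
  damped further by powers of c when c < 1. Both cases use the same argument: it needs only a
  bilinear form that is nonnegative on a convex cone with a unit. The real work of the quantum case
  is that <\<psi>| A \<otimes> B |\<psi>> is such a form; its nonnegativity is derived from the
  Schur product theorem.\<close>

section \<open>Expectations over finitely supported distributions\<close>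

lemma expectation_finite:
  fixes f :: "'a \<Rightarrow> real"
  assumes "finite (set_pmf p)"
  shows "measure_pmf.expectation p f = (\<Sum>x\<in>set_pmf p. pmf p x * f x)"
  using assms by (subst integral_measure_pmf[of "set_pmf p"]) auto

lemma expectation_cong:
  fixes f g :: "'a \<Rightarrow> real"
  assumes "finite (set_pmf p)" "\<And>x. x \<in> set_pmf p \<Longrightarrow> f x = g x"
  shows "measure_pmf.expectation p f = measure_pmf.expectation p g"
  using assms by (simp add: expectation_finite)

lemma expectation_mono:
  fixes f g :: "'a \<Rightarrow> real"
  assumes "finite (set_pmf p)" "\<And>x. x \<in> set_pmf p \<Longrightarrow> f x \<le> g x"
  shows "measure_pmf.expectation p f \<le> measure_pmf.expectation p g"
  using assms by (simp add: expectation_finite sum_mono mult_left_mono)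

lemma expectation_le_const:
  fixes f :: "'a \<Rightarrow> real"
  assumes "finite (set_pmf p)" "\<And>x. x \<in> set_pmf p \<Longrightarrow> f x \<le> c"
  shows "measure_pmf.expectation p f \<le> c"
  using expectation_mono[OF assms(1), of f "\<lambda>_. c"] assms(2) by simp

lemma expectation_sum:
  fixes f :: "'a \<Rightarrow> 'b \<Rightarrow> real"
  assumes "finite (set_pmf p)"
  shows "measure_pmf.expectation p (\<lambda>x. \<Sum>i\<in>I. f x i) = (\<Sum>i\<in>I. measure_pmf.expectation p (\<lambda>x. f x i))"
  by (intro Bochner_Integration.integral_sum integrable_measure_pmf_finite assms)

lemma expectation_swap:
  fixes f :: "'a \<Rightarrow> 'b \<Rightarrow> real"
  assumes "finite (set_pmf p)" "finite (set_pmf q)"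
  shows "measure_pmf.expectation p (\<lambda>x. measure_pmf.expectation q (f x)) =
         measure_pmf.expectation q (\<lambda>y. measure_pmf.expectation p (\<lambda>x. f x y))"
  using assms by (simp add: expectation_finite sum_distrib_left mult_ac sum.swap[of _ "set_pmf p"])

lemma expectation_bind:
  fixes h :: "'b \<Rightarrow> real"
  assumes "finite (set_pmf p)" "\<And>x. x \<in> set_pmf p \<Longrightarrow> finite (set_pmf (f x))"
  shows "measure_pmf.expectation (p \<bind> f) h =
         measure_pmf.expectation p (\<lambda>x. measure_pmf.expectation (f x) h)"
  using assms pmf_expectation_bind[OF assms(1), of f p h] by (simp add: expectation_finite)

lemma expectation_pair:
  fixes h :: "'a \<times> 'b \<Rightarrow> real"
  assumes "finite (set_pmf p)" "finite (set_pmf q)"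
  shows "measure_pmf.expectation (pair_pmf p q) h =
         measure_pmf.expectation p (\<lambda>x. measure_pmf.expectation q (\<lambda>y. h (x, y)))"
  unfolding pair_pmf_def using assms
  by (simp add: expectation_bind set_bind_pmf)

lemma sum_PiE_Suc:
  "(\<Sum>a\<in>(\<Pi>\<^sub>E i\<in>{..<Suc k}. T i). g a) = (\<Sum>a0\<in>T k. \<Sum>a\<in>(\<Pi>\<^sub>E i\<in>{..<k}. T i). g (a(k := a0)))"
proof -
  have "(\<Sum>a\<in>(\<Pi>\<^sub>E i\<in>{..<Suc k}. T i). g a) =
        (\<Sum>a\<in>(\<lambda>(y, g). g(k := y)) ` (T k \<times> Pi\<^sub>E {..<k} T). g a)"
    unfolding lessThan_Suc PiE_insert_eq ..
  also have "\<dots> = (\<Sum>(a0, a)\<in>T k \<times> Pi\<^sub>E {..<k} T. g (a(k := a0)))"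
    by (subst sum.reindex[OF inj_combinator]) (auto simp: case_prod_unfold)
  also have "\<dots> = (\<Sum>a0\<in>T k. \<Sum>a\<in>(\<Pi>\<^sub>E i\<in>{..<k}. T i). g (a(k := a0)))"
    by (rule sum.cartesian_product[symmetric])
  finally show ?thesis .
qed

section \<open>Refereed games with finite support\<close>

text \<open>Collects what makes the expectations and sums below finite. Concatenated games have this
  property and repetition preserves it, so the recursion can be carried out for an abstract game
  \<open>R\<close>.\<close>

definition finite_game :: "('r, 'p, 'q, 'a, 'b) refereed_game \<Rightarrow> bool" where
  "finite_game R \<longleftrightarrow> finite (set_pmf (referee R)) \<and>
     (\<forall>r\<in>set_pmf (referee R). ask1 R r \<in> quest1 R \<and> ask2 R r \<in> quest2 R) \<and>
     (\<forall>q\<in>quest1 R. finite (ans1 R q)) \<and> (\<forall>q\<in>quest2 R. finite (ans2 R q))"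

lemma finite_gameD:
  assumes "finite_game R"
  shows "finite (set_pmf (referee R))"
    and "r \<in> set_pmf (referee R) \<Longrightarrow> ask1 R r \<in> quest1 R"
    and "r \<in> set_pmf (referee R) \<Longrightarrow> ask2 R r \<in> quest2 R"
    and "q \<in> quest1 R \<Longrightarrow> finite (ans1 R q)"
    and "q' \<in> quest2 R \<Longrightarrow> finite (ans2 R q')"
    and "r \<in> set_pmf (referee R) \<Longrightarrow> finite (accepted R r)"
  using assms
  by (auto simp: finite_game_def accepted_def intro: finite_subset[OF _ finite_cartesian_product])

lemma repeated_game_simps [simp]:
  "referee (repeated_game k R) = Pi_pmf {..<k} undefined (\<lambda>_. referee R)"
  "quest1 (repeated_game k R) = {..<k} \<rightarrow>\<^sub>E quest1 R"
  "quest2 (repeated_game k R) = {..<k} \<rightarrow>\<^sub>E quest2 R"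
  "ask1 (repeated_game k R) r = (\<lambda>i\<in>{..<k}. ask1 R (r i))"
  "ask2 (repeated_game k R) r = (\<lambda>i\<in>{..<k}. ask2 R (r i))"
  "ans1 (repeated_game k R) = (\<lambda>q. \<Pi>\<^sub>E i\<in>{..<k}. ans1 R (q i))"
  "ans2 (repeated_game k R) = (\<lambda>q. \<Pi>\<^sub>E i\<in>{..<k}. ans2 R (q i))"
  "wins (repeated_game k R) r a b \<longleftrightarrow> (\<forall>i<k. wins R (r i) (a i) (b i))"
  by (simp_all add: repeated_game_def)

lemma repeated_game_supportD:
  "r \<in> set_pmf (referee (repeated_game k R)) \<Longrightarrow> i < k \<Longrightarrow> r i \<in> set_pmf (referee R)"
  by (auto simp: set_Pi_pmf PiE_dflt_def)

lemma finite_repeated_game: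
  assumes "finite_game R"
  shows "finite_game (repeated_game k R)"
  unfolding finite_game_def repeated_game_simps
proof (intro conjI ballI)
  show "finite (set_pmf (Pi_pmf {..<k} undefined (\<lambda>_. referee R)))"
    by (simp add: set_Pi_pmf finite_PiE_dflt finite_gameD[OF assms])
  fix r assume "r \<in> set_pmf (Pi_pmf {..<k} undefined (\<lambda>_. referee R))"
  then have "r i \<in> set_pmf (referee R)" if "i < k" for i
    using repeated_game_supportD[of r k R i] that by simp
  then show "(\<lambda>i\<in>{..<k}. ask1 R (r i)) \<in> {..<k} \<rightarrow>\<^sub>E quest1 R"
    "(\<lambda>i\<in>{..<k}. ask2 R (r i)) \<in> {..<k} \<rightarrow>\<^sub>E quest2 R"
    using finite_gameD[OF assms] by (auto intro!: restrict_PiE_iff[THEN iffD2])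
next
  show "finite (\<Pi>\<^sub>E i\<in>{..<k}. ans1 R (q i))" if "q \<in> {..<k} \<rightarrow>\<^sub>E quest1 R" for q
    using that finite_gameD[OF assms] by (intro finite_PiE) (auto simp: PiE_iff)
  show "finite (\<Pi>\<^sub>E i\<in>{..<k}. ans2 R (q i))" if "q \<in> {..<k} \<rightarrow>\<^sub>E quest2 R" for q
    using that finite_gameD[OF assms] by (intro finite_PiE) (auto simp: PiE_iff)
qed

section \<open>Splitting off the last round\<close>

lemma restrict_Suc_upd:
  "(\<lambda>i\<in>{..<Suc k}. f ((r(k := s)) i)) = (\<lambda>i\<in>{..<k}. f (r i))(k := f s)"
  by (auto simp: fun_eq_iff)

lemma restrict_Suc_0_upd: "(\<lambda>i\<in>{..<Suc 0}. f ((r(0 := s)) i)) = (\<lambda>_. undefined)(0 := f s)"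
  by (auto simp: fun_eq_iff)

lemma PiE_upd_Suc: "q \<in> {..<k} \<rightarrow>\<^sub>E Q \<Longrightarrow> x \<in> Q \<Longrightarrow> q(k := x) \<in> {..<Suc k} \<rightarrow>\<^sub>E Q"
  by (auto simp: lessThan_Suc PiE_insert_eq intro: rev_image_eqI)

lemma PiE_Suc_upd_fun: "(\<Pi>\<^sub>E i\<in>{..<Suc k}. S ((q(k := x)) i)) = (\<lambda>(y, g). g(k := y)) ` (S x \<times> (\<Pi>\<^sub>E i\<in>{..<k}. S (q i)))"
proof -
  have "(\<Pi>\<^sub>E i\<in>{..<k}. S ((q(k := x)) i)) = (\<Pi>\<^sub>E i\<in>{..<k}. S (q i))"
    by (intro PiE_cong) auto
  then show ?thesis unfolding lessThan_Suc PiE_insert_eq by simp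
qed

text \<open>Winning is a conjunction over rounds and answer sets are products, so accepted pairs of
  tuples factor into the first \<open>k\<close> rounds and round \<open>k\<close>.\<close>

lemma sum_accepted_Suc:
  "(\<Sum>(a, b)\<in>accepted (repeated_game (Suc k) R) (r(k := s)). g a b) =
   (\<Sum>(a, b)\<in>accepted (repeated_game k R) r. \<Sum>(a0, b0)\<in>accepted R s. g (a(k := a0)) (b(k := b0)))"
proof -
  let ?j = "\<lambda>((a, b), (a0, b0)). (a(k := a0), b(k := b0))"
  let ?A = "accepted (repeated_game k R) r \<times> accepted R s"
  have eq: "accepted (repeated_game (Suc k) R) (r(k := s)) = ?j ` ?A"
  proof (intro equalityI subsetI)
    fix z assume "z \<in> accepted (repeated_game (Suc k) R) (r(k := s))"
    then obtain a b where z: "z = (a, b)"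
      and a: "a \<in> (\<Pi>\<^sub>E i\<in>{..<Suc k}. ans1 R (((\<lambda>i\<in>{..<k}. ask1 R (r i))(k := ask1 R s)) i))"
      and b: "b \<in> (\<Pi>\<^sub>E i\<in>{..<Suc k}. ans2 R (((\<lambda>i\<in>{..<k}. ask2 R (r i))(k := ask2 R s)) i))"
      and w: "\<forall>i<Suc k. wins R ((r(k := s)) i) (a i) (b i)"
      unfolding accepted_def repeated_game_simps restrict_Suc_upd by blast
    from a obtain a0 a' where a': "a0 \<in> ans1 R (ask1 R s)" "a = a'(k := a0)"
      "a' \<in> (\<Pi>\<^sub>E i\<in>{..<k}. ans1 R ((\<lambda>i\<in>{..<k}. ask1 R (r i)) i))"
      unfolding PiE_Suc_upd_fun by auto
    from b obtain b0 b' where b': "b0 \<in> ans2 R (ask2 R s)" "b = b'(k := b0)"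
      "b' \<in> (\<Pi>\<^sub>E i\<in>{..<k}. ans2 R ((\<lambda>i\<in>{..<k}. ask2 R (r i)) i))"
      unfolding PiE_Suc_upd_fun by auto
    have "wins R s a0 b0" using w[rule_format, of k] a'(2) b'(2) by simp
    moreover have "\<forall>i<k. wins R (r i) (a' i) (b' i)"
    proof (intro allI impI)
      fix i assume "i < k" then show "wins R (r i) (a' i) (b' i)"
        using w[rule_format, of i] a'(2) b'(2) by simp
    qed
    ultimately have "((a', b'), (a0, b0)) \<in> ?A"
      unfolding accepted_def repeated_game_simps using a' b' by simp
    then show "z \<in> ?j ` ?A" unfolding z a'(2) b'(2) by force
  next
    fix z assume "z \<in> ?j ` ?A"
    then obtain a b a0 b0 where z: "z = (a(k := a0), b(k := b0))"
      and ab: "(a, b) \<in> accepted (repeated_game k R) r" "(a0, b0) \<in> accepted R s" by auto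
    have "a(k := a0) \<in> (\<Pi>\<^sub>E i\<in>{..<Suc k}. ans1 R (((\<lambda>i\<in>{..<k}. ask1 R (r i))(k := ask1 R s)) i))"
      unfolding PiE_Suc_upd_fun by (rule image_eqI[of _ _ "(a0, a)"]) (use ab in \<open>auto simp: accepted_def\<close>)
    moreover have "b(k := b0) \<in> (\<Pi>\<^sub>E i\<in>{..<Suc k}. ans2 R (((\<lambda>i\<in>{..<k}. ask2 R (r i))(k := ask2 R s)) i))"
      unfolding PiE_Suc_upd_fun by (rule image_eqI[of _ _ "(b0, b)"]) (use ab in \<open>auto simp: accepted_def\<close>)
    moreover have "\<forall>i<Suc k. wins R ((r(k := s)) i) ((a(k := a0)) i) ((b(k := b0)) i)"
      using ab by (auto simp: accepted_def less_Suc_eq)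
    ultimately show "z \<in> accepted (repeated_game (Suc k) R) (r(k := s))"
      unfolding z accepted_def repeated_game_simps restrict_Suc_upd by blast
  qed
  have inj: "inj_on ?j ?A"
  proof (rule inj_onI, clarsimp)
    fix a b a0 b0 c d c0 d0
    assume ac: "(a, b) \<in> accepted (repeated_game k R) r" "(c, d) \<in> accepted (repeated_game k R) r"
      and eq: "a(k := a0) = c(k := c0)" "b(k := b0) = d(k := d0)"
    \<comment> \<open>Tuples for \<open>k\<close> rounds are \<open>undefined\<close> at
      \<open>k\<close>; resetting this entry recovers them from their extensions.\<close>
    have u: "a k = undefined" "b k = undefined" "c k = undefined" "d k = undefined"
      using ac by (auto simp: accepted_def PiE_def extensional_def)
    have "a = (a(k := a0))(k := undefined)" using u by auto
    also have "\<dots> = c" unfolding eq using u by auto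
    finally have 1: "a = c" .
    have "b = (b(k := b0))(k := undefined)" using u by auto
    also have "\<dots> = d" unfolding eq using u by auto
    finally have 2: "b = d" .
    show "a = c \<and> b = d \<and> a0 = c0 \<and> b0 = d0"
      using 1 2 fun_cong[OF eq(1), of k] fun_cong[OF eq(2), of k] by simp
  qed
  show ?thesis unfolding eq by (subst sum.reindex[OF inj]) (simp add: case_prod_unfold sum.cartesian_product)
qed

text \<open>\<open>Pi_pmf_insert\<close> puts the new round outermost; the order is exchanged
  because the argument fixes the first \<open>k\<close> rounds before averaging over the
  last.\<close>

lemma expectation_repeated_Suc:
  fixes h :: "_ \<Rightarrow> real"
  assumes "finite_game R"
  shows "measure_pmf.expectation (referee (repeated_game (Suc k) R)) h =
    measure_pmf.expectation (referee (repeated_game k R)) (\<lambda>r.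
      measure_pmf.expectation (referee R) (\<lambda>s. h (r(k := s))))"
proof -
  have f: "finite (set_pmf (referee R))" "finite (set_pmf (Pi_pmf {..<k} undefined (\<lambda>_. referee R)))"
    using finite_gameD(1)[OF assms] finite_gameD(1)[OF finite_repeated_game[OF assms, of k]] by auto
  have "measure_pmf.expectation (referee (repeated_game (Suc k) R)) h =
      measure_pmf.expectation (referee R) (\<lambda>s.
        measure_pmf.expectation (Pi_pmf {..<k} undefined (\<lambda>_. referee R)) (\<lambda>r. h (r(k := s))))"
    by (simp add: lessThan_Suc Pi_pmf_insert case_prod_unfold expectation_pair[OF f])
  then show ?thesis
    by (simp only: repeated_game_simps expectation_swap[OF f])
qed

text \<open>
  The substrategy for round \<open>k\<close> that remains once the first \<open>k\<close> questions are \<open>q\<close> and the answers to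
  them have the inner answers \<open>\<alpha>\<close>; \<open>v i\<close> reads the inner answer off the answer in round \<open>i\<close>.
\<close>

definition conditioned ::
    "nat \<Rightarrow> ('p \<Rightarrow> 'a set) \<Rightarrow> (nat \<Rightarrow> 'p) \<Rightarrow> (nat \<Rightarrow> 'a \<Rightarrow> 'c) \<Rightarrow> (nat \<Rightarrow> 'c) \<Rightarrow>
     ((nat \<Rightarrow> 'p) \<Rightarrow> (nat \<Rightarrow> 'a) \<Rightarrow> 'u::comm_monoid_add) \<Rightarrow> 'p \<Rightarrow> 'a \<Rightarrow> 'u" where
  "conditioned k S q v \<alpha> F x a0 =
     (\<Sum>a | a \<in> (\<Pi>\<^sub>E i\<in>{..<k}. S (q i)) \<and> (\<lambda>i\<in>{..<k}. v i (a i)) = \<alpha>. F (q(k := x)) (a(k := a0)))"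

text \<open>A strategy for \<open>k\<close> rounds: question \<open>k\<close> is set to a fixed
  \<open>x\<close> and its answer is summed out. The average over the last questions is taken later,
  outside \<phi>, because the two players' questions are correlated.\<close>

definition marginal ::
    "nat \<Rightarrow> ('p \<Rightarrow> 'a set) \<Rightarrow> 'p \<Rightarrow> ((nat \<Rightarrow> 'p) \<Rightarrow> (nat \<Rightarrow> 'a) \<Rightarrow> 'u::comm_monoid_add) \<Rightarrow>
     (nat \<Rightarrow> 'p) \<Rightarrow> (nat \<Rightarrow> 'a) \<Rightarrow> 'u" where
  "marginal k S x F q a = (\<Sum>a0\<in>S x. F (q(k := x)) (a(k := a0)))"

lemma sum_upd_Suc:
  fixes g :: "_ \<Rightarrow> 'w::comm_monoid_add"
  shows "(\<Sum>a\<in>(\<Pi>\<^sub>E i\<in>{..<Suc k}. S ((q(k := x)) i)). g a) =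
   (\<Sum>a\<in>(\<Pi>\<^sub>E i\<in>{..<k}. S (q i)). \<Sum>a0\<in>S x. g (a(k := a0)))"
proof -
  have "(\<Pi>\<^sub>E i\<in>{..<k}. S ((q(k := x)) i)) = (\<Pi>\<^sub>E i\<in>{..<k}. S (q i))"
    by (intro PiE_cong) auto
  then show ?thesis unfolding sum_PiE_Suc by (simp only: fun_upd_same) (rule sum.swap)
qed

lemma upd_PiE_Suc:
  assumes "a \<in> (\<Pi>\<^sub>E i\<in>{..<k}. S (q i))" "a0 \<in> S x"
  shows "a(k := a0) \<in> (\<Pi>\<^sub>E i\<in>{..<Suc k}. S ((q(k := x)) i))"
  unfolding PiE_Suc_upd_fun by (rule image_eqI[of _ _ "(a0, a)"]) (use assms in auto)

text \<open>Summing out the last answer commutes with grouping by inner answers. Totals of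
  conditioned substrategies are therefore blocks of the marginal strategy, and masses can be
  reassembled into a value for \<open>k\<close> rounds.\<close>

lemma sum_conditioned:
  "(\<Sum>a0\<in>S x. conditioned k S q v \<alpha> F x a0) =
   (\<Sum>a | a \<in> (\<Pi>\<^sub>E i\<in>{..<k}. S (q i)) \<and> (\<lambda>i\<in>{..<k}. v i (a i)) = \<alpha>. marginal k S x F q a)"
  unfolding conditioned_def marginal_def by (rule sum.swap)

section \<open>Bilinear correlations\<close>

text \<open>
  The classical case is \<open>\<phi> = (*)\<close> on the nonnegative reals. In the entangled case \<open>K\<close> is the cone of
  positive semidefinite matrices and \<open>\<phi> A B = \<langle>\<psi>| A \<otimes> B |\<psi>\<rangle>\<close>, with the same \<open>\<psi>\<close> for every strategy
  that occurs in the induction on the number of rounds.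
\<close>

locale correlation =
  fixes \<phi> :: "'u::real_vector \<Rightarrow> 'u \<Rightarrow> real" and K :: "'u set" and e :: 'u
  assumes bilinear: "bilinear \<phi>"
    and add_K: "u \<in> K \<Longrightarrow> v \<in> K \<Longrightarrow> u + v \<in> K"
    and scale_K: "0 \<le> c \<Longrightarrow> u \<in> K \<Longrightarrow> c *\<^sub>R u \<in> K"
    and unit_K: "e \<in> K"
    and nonneg: "u \<in> K \<Longrightarrow> v \<in> K \<Longrightarrow> 0 \<le> \<phi> u v"
    and unit: "\<phi> e e = 1"
begin

lemma zero_K: "0 \<in> K"
  using scale_K[of 0, OF _ unit_K] by simp

lemma sum_K: "(\<And>i. i \<in> I \<Longrightarrow> f i \<in> K) \<Longrightarrow> sum f I \<in> K"
  by (induction I rule: infinite_finite_induct) (auto intro: zero_K add_K)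

text \<open>Membership of the difference in \<open>K\<close> is the order given by the cone:
  \<open>\<le> 1\<close> for reals, the Loewner order below the identity for matrices.\<close>

definition subPOVM :: "'q set \<Rightarrow> ('q \<Rightarrow> 'a set) \<Rightarrow> ('q \<Rightarrow> 'a \<Rightarrow> 'u) \<Rightarrow> bool" where
  "subPOVM Q S F \<longleftrightarrow> (\<forall>q\<in>Q. (\<forall>a\<in>S q. F q a \<in> K) \<and> e - (\<Sum>a\<in>S q. F q a) \<in> K)"

definition POVM :: "'q set \<Rightarrow> ('q \<Rightarrow> 'a set) \<Rightarrow> ('q \<Rightarrow> 'a \<Rightarrow> 'u) \<Rightarrow> bool" where
  "POVM Q S F \<longleftrightarrow> (\<forall>q\<in>Q. (\<forall>a\<in>S q. F q a \<in> K) \<and> (\<Sum>a\<in>S q. F q a) = e)"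

definition game_value ::
    "('r, 'p, 'q, 'a, 'b) refereed_game \<Rightarrow> ('p \<Rightarrow> 'a \<Rightarrow> 'u) \<Rightarrow> ('q \<Rightarrow> 'b \<Rightarrow> 'u) \<Rightarrow> real" where
  "game_value R F H = measure_pmf.expectation (referee R)
     (\<lambda>r. \<Sum>(a, b)\<in>accepted R r. \<phi> (F (ask1 R r) a) (H (ask2 R r) b))"

text \<open>The factor that multiplies Val(G) + \<epsilon> in weak fortification, expressed through
  the game itself; \<open>mass_concat\<close> rewrites it in terms of induced strategies.\<close>

definition mass ::
    "('r, 'p, 'q, 'a, 'b) refereed_game \<Rightarrow> ('p \<Rightarrow> 'a \<Rightarrow> 'u) \<Rightarrow> ('q \<Rightarrow> 'b \<Rightarrow> 'u) \<Rightarrow> real" where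
  "mass R F H = measure_pmf.expectation (referee R)
     (\<lambda>r. \<phi> (\<Sum>a\<in>ans1 R (ask1 R r). F (ask1 R r) a) (\<Sum>b\<in>ans2 R (ask2 R r). H (ask2 R r) b))"

lemma POVM_D:
  assumes "POVM Q S F" "q \<in> Q"
  shows "a \<in> S q \<Longrightarrow> F q a \<in> K" "(\<Sum>a\<in>S q. F q a) = e"
  using assms by (auto simp: POVM_def)

lemma \<phi>_sum: "\<phi> (sum f S) (sum g T) = (\<Sum>a\<in>S. \<Sum>b\<in>T. \<phi> (f a) (g b))"
  by (simp add: bilinear_sum[OF bilinear] sum.cartesian_product)

text \<open>Bilinearity turns \<phi> of two block sums into a sum over a product block, and these
  blocks partition the pairs whose labels lie in \<open>T\<close>. The labels will be tuples of
  inner answers in the recursion and a'(x), b'(y) in a single round.\<close>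

lemma sum_fibres:
  assumes "finite S" "finite S'" "finite T"
  shows "(\<Sum>(c, d)\<in>T. \<phi> (\<Sum>a | a \<in> S \<and> u a = c. f a) (\<Sum>b | b \<in> S' \<and> v b = d. h b)) =
         (\<Sum>(a, b)\<in>{(a, b) \<in> S \<times> S'. (u a, v b) \<in> T}. \<phi> (f a) (h b))"
proof -
  let ?A = "{(a, b) \<in> S \<times> S'. (u a, v b) \<in> T}"
  have fin: "finite ?A" using assms by (auto intro: finite_subset[of _ "S \<times> S'"])
  have "(\<Sum>(a, b)\<in>?A. \<phi> (f a) (h b)) =
    (\<Sum>t\<in>T. \<Sum>z\<in>{z \<in> ?A. (u (fst z), v (snd z)) = t}. \<phi> (f (fst z)) (h (snd z)))"
    using fin assms(3) by (subst sum.group) (auto simp: case_prod_unfold)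
  also have "\<dots> = (\<Sum>(c, d)\<in>T. \<phi> (\<Sum>a | a \<in> S \<and> u a = c. f a) (\<Sum>b | b \<in> S' \<and> v b = d. h b))"
  proof (intro sum.cong refl, clarify)
    fix c d assume "(c, d) \<in> T"
    then have "{z \<in> ?A. (u (fst z), v (snd z)) = (c, d)} =
        {a. a \<in> S \<and> u a = c} \<times> {b. b \<in> S' \<and> v b = d}" by auto
    then show "(\<Sum>z\<in>{z \<in> ?A. (u (fst z), v (snd z)) = (c, d)}. \<phi> (f (fst z)) (h (snd z))) =
        \<phi> (\<Sum>a | a \<in> S \<and> u a = c. f a) (\<Sum>b | b \<in> S' \<and> v b = d. h b)"
      by (simp add: \<phi>_sum sum.cartesian_product case_prod_unfold)
  qed
  finally show ?thesis ..
qed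

text \<open>By nonnegativity the rejected pairs may be added, and the sum over all pairs is
  \<open>\<phi> e e = 1\<close>. This bounds the suprema and settles the case
  \<open>1 \<le> c\<close> of the final estimate.\<close>

lemma game_value_le_1:
  assumes R: "finite_game R" and F: "POVM (quest1 R) (ans1 R) F" and H: "POVM (quest2 R) (ans2 R) H"
  shows "game_value R F H \<le> 1"
  unfolding game_value_def
proof (rule expectation_le_const)
  show "finite (set_pmf (referee R))" by (rule finite_gameD(1)[OF R])
  fix r assume r: "r \<in> set_pmf (referee R)"
  let ?A = "ans1 R (ask1 R r)" and ?B = "ans2 R (ask2 R r)"
  have fin: "finite ?A" "finite ?B" using finite_gameD[OF R] r by auto
  have "(\<Sum>(a, b)\<in>accepted R r. \<phi> (F (ask1 R r) a) (H (ask2 R r) b)) \<le>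
        (\<Sum>(a, b)\<in>?A \<times> ?B. \<phi> (F (ask1 R r) a) (H (ask2 R r) b))"
    by (rule sum_mono2) (use fin r finite_gameD[OF R] POVM_D(1)[OF F] POVM_D(1)[OF H] in
        \<open>auto simp: accepted_def intro!: nonneg\<close>)
  also have "\<dots> = \<phi> (\<Sum>a\<in>?A. F (ask1 R r) a) (\<Sum>b\<in>?B. H (ask2 R r) b)"
    by (simp add: \<phi>_sum sum.cartesian_product)
  also have "\<dots> = 1"
    using POVM_D(2)[OF F] POVM_D(2)[OF H] r finite_gameD[OF R] by (simp add: unit)
  finally show "(\<Sum>(a, b)\<in>accepted R r. \<phi> (F (ask1 R r) a) (H (ask2 R r) b)) \<le> 1" .
qed

lemma POVM_marginal:
  assumes F: "POVM ({..<Suc k} \<rightarrow>\<^sub>E Q) (\<lambda>q. \<Pi>\<^sub>E i\<in>{..<Suc k}. S (q i)) F" and x: "x \<in> Q"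
  shows "POVM ({..<k} \<rightarrow>\<^sub>E Q) (\<lambda>q. \<Pi>\<^sub>E i\<in>{..<k}. S (q i)) (marginal k S x F)"
  unfolding POVM_def
proof (intro ballI conjI)
  fix q assume q: "q \<in> {..<k} \<rightarrow>\<^sub>E Q"
  note q' = PiE_upd_Suc[OF q x]
  show "(\<Sum>a\<in>(\<Pi>\<^sub>E i\<in>{..<k}. S (q i)). marginal k S x F q a) = e"
    using POVM_D(2)[OF F q'] unfolding sum_upd_Suc marginal_def .
  show "marginal k S x F q a \<in> K" if "a \<in> (\<Pi>\<^sub>E i\<in>{..<k}. S (q i))" for a
    unfolding marginal_def by (intro sum_K POVM_D(1)[OF F q'] upd_PiE_Suc that)
qed

text \<open>What the conditioned sum lacks from \<open>e\<close> is the sum over the tuples with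
  other inner answers, again a sum of elements of \<open>K\<close>.\<close>

lemma subPOVM_conditioned:
  assumes F: "POVM ({..<Suc k} \<rightarrow>\<^sub>E Q) (\<lambda>q. \<Pi>\<^sub>E i\<in>{..<Suc k}. S (q i)) F"
    and q: "q \<in> {..<k} \<rightarrow>\<^sub>E Q" and fin: "\<And>q. q \<in> Q \<Longrightarrow> finite (S q)"
  shows "subPOVM Q S (conditioned k S q v \<alpha> F)"
  unfolding subPOVM_def
proof (intro ballI conjI)
  fix x assume x: "x \<in> Q"
  note q' = PiE_upd_Suc[OF q x]
  let ?P = "\<Pi>\<^sub>E i\<in>{..<k}. S (q i)"
  let ?C = "{a. a \<in> ?P \<and> (\<lambda>i\<in>{..<k}. v i (a i)) = \<alpha>}"
  have finP: "finite ?P" using q fin by (intro finite_PiE) auto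
  have K: "F (q(k := x)) (a(k := a0)) \<in> K" if "a \<in> ?P" "a0 \<in> S x" for a a0
    by (intro POVM_D(1)[OF F q'] upd_PiE_Suc that)
  show "conditioned k S q v \<alpha> F x a0 \<in> K" if "a0 \<in> S x" for a0
    unfolding conditioned_def by (intro sum_K K that) auto
  have "e = (\<Sum>a\<in>?P. \<Sum>a0\<in>S x. F (q(k := x)) (a(k := a0)))"
    using POVM_D(2)[OF F q'] unfolding sum_upd_Suc by simp
  also have "\<dots> = (\<Sum>a\<in>?P - ?C. \<Sum>a0\<in>S x. F (q(k := x)) (a(k := a0))) +
      (\<Sum>a\<in>?C. \<Sum>a0\<in>S x. F (q(k := x)) (a(k := a0)))"
    by (rule sum.subset_diff) (use finP in auto)
  also have "(\<Sum>a\<in>?C. \<Sum>a0\<in>S x. F (q(k := x)) (a(k := a0))) =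
      (\<Sum>a0\<in>S x. conditioned k S q v \<alpha> F x a0)"
    unfolding conditioned_def by (rule sum.swap)
  finally have "e - (\<Sum>a0\<in>S x. conditioned k S q v \<alpha> F x a0) =
      (\<Sum>a\<in>?P - ?C. \<Sum>a0\<in>S x. F (q(k := x)) (a(k := a0)))"
    by (simp only: add_diff_cancel_right')
  also have "\<dots> \<in> K" by (intro sum_K K) auto
  finally show "e - (\<Sum>a0\<in>S x. conditioned k S q v \<alpha> F x a0) \<in> K" .
qed

end

section \<open>The recursion from k to k + 1 rounds\<close>

text \<open>The verdict factors through the labels \<open>u a\<close>, \<open>v b\<close>, so the
  winning label pairs pull back to exactly the accepted pairs.\<close>

lemma accepted_image:
  assumes "\<And>a. a \<in> A \<Longrightarrow> u a \<in> C" "\<And>b. b \<in> B \<Longrightarrow> v b \<in> D"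
    and "\<And>a b. w a b \<longleftrightarrow> Q (u a) (v b)"
  shows "{(a, b) \<in> A \<times> B. (u a, v b) \<in> {(\<alpha>, \<beta>) \<in> C \<times> D. Q \<alpha> \<beta>}} = {(a, b) \<in> A \<times> B. w a b}"
  using assms by auto

context correlation begin

text \<open>The recursion for any game whose verdict depends on the answers only through labels
  \<open>ev1 r a\<close>, \<open>ev2 r b\<close> from finite sets. For \<open>G'\<close> they are
  a'(x) and b'(y); they involve \<open>r\<close>, as the players do not see x and y.\<close>

lemma game_value_Suc_le:
  assumes R: "finite_game R"
    and F: "POVM (quest1 (repeated_game (Suc k) R)) (ans1 (repeated_game (Suc k) R)) F"
    and H: "POVM (quest2 (repeated_game (Suc k) R)) (ans2 (repeated_game (Suc k) R)) H"
    and finC: "finite C" and finD: "finite D"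
    and ev1: "\<And>r a. r \<in> set_pmf (referee R) \<Longrightarrow> a \<in> ans1 R (ask1 R r) \<Longrightarrow> ev1 r a \<in> C"
    and ev2: "\<And>r b. r \<in> set_pmf (referee R) \<Longrightarrow> b \<in> ans2 R (ask2 R r) \<Longrightarrow> ev2 r b \<in> D"
    and wins: "\<And>r a b. wins R r a b \<longleftrightarrow> V r (ev1 r a) (ev2 r b)"
    and fortified: "\<And>F H. subPOVM (quest1 R) (ans1 R) F \<Longrightarrow> subPOVM (quest2 R) (ans2 R) H \<Longrightarrow>
      game_value R F H \<le> c * mass R F H + \<delta>"
    and bound: "\<And>F H. POVM (quest1 (repeated_game k R)) (ans1 (repeated_game k R)) F \<Longrightarrow>
      POVM (quest2 (repeated_game k R)) (ans2 (repeated_game k R)) H \<Longrightarrow>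
      game_value (repeated_game k R) F H \<le> w"
    and nn: "0 \<le> c" "0 \<le> \<delta>"
  shows "game_value (repeated_game (Suc k) R) F H \<le> c * w + \<delta> * real (card C * card D) ^ k"
proof -
  let ?Rk = "repeated_game k R"
  let ?E = "\<lambda>f::_ \<Rightarrow> real. measure_pmf.expectation (referee R) f"
  let ?Ek = "\<lambda>f::_ \<Rightarrow> real. measure_pmf.expectation (referee ?Rk) f"
  \<comment> \<open>The winning label tuples of the first \<open>k\<close> rounds. Fortification is
    invoked once for each, so \<open>card (T r)\<close> counts how often \<delta> is paid.\<close>
  define T where "T r = {(\<alpha>, \<beta>) \<in> ({..<k} \<rightarrow>\<^sub>E C) \<times> ({..<k} \<rightarrow>\<^sub>E D). \<forall>i<k. V (r i) (\<alpha> i) (\<beta> i)}" for r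
  \<comment> \<open>The labels are read with the referee's full sample \<open>r\<close>, unknown to
    the players. This is harmless: \<open>r\<close> is fixed before round \<open>k\<close> is
    sampled, and only the existence of the substrategy matters.\<close>
  define F' where "F' r \<alpha> = conditioned k (ans1 R) (ask1 ?Rk r) (\<lambda>i. ev1 (r i)) \<alpha> F" for r \<alpha>
  define H' where "H' r \<beta> = conditioned k (ans2 R) (ask2 ?Rk r) (\<lambda>i. ev2 (r i)) \<beta> H" for r \<beta>
  note Rk = finite_repeated_game[OF R, of k]
  note fin = finite_gameD(1)[OF R] and fink = finite_gameD(1)[OF Rk]
  have finT: "finite (T r)" for r
    unfolding T_def using finC finD
    by (auto intro!: finite_subset[of _ "({..<k} \<rightarrow>\<^sub>E C) \<times> ({..<k} \<rightarrow>\<^sub>E D)"] finite_cartesian_product finite_PiE)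
  have cardT: "real (card (T r)) \<le> real (card C * card D) ^ k" for r
  proof -
    have "card (T r) \<le> card (({..<k} \<rightarrow>\<^sub>E C) \<times> ({..<k} \<rightarrow>\<^sub>E D))"
      unfolding T_def using finC finD
      by (intro card_mono finite_cartesian_product finite_PiE) auto
    also have "\<dots> = (card C * card D) ^ k"
      by (simp add: card_cartesian_product card_PiE power_mult_distrib)
    finally show ?thesis by (simp only: of_nat_power[symmetric] of_nat_le_iff)
  qed
  have acc: "{(a, b) \<in> ans1 ?Rk (ask1 ?Rk r) \<times> ans2 ?Rk (ask2 ?Rk r).
      ((\<lambda>i\<in>{..<k}. ev1 (r i) (a i)), (\<lambda>i\<in>{..<k}. ev2 (r i) (b i))) \<in> T r} = accepted ?Rk r"
    if r: "r \<in> set_pmf (referee ?Rk)" for r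
  proof -
    have "(\<lambda>i\<in>{..<k}. ev1 (r i) (a i)) \<in> {..<k} \<rightarrow>\<^sub>E C" if "a \<in> ans1 ?Rk (ask1 ?Rk r)" for a
      using that repeated_game_supportD[OF r] by (auto simp: PiE_iff intro!: ev1)
    moreover have "(\<lambda>i\<in>{..<k}. ev2 (r i) (b i)) \<in> {..<k} \<rightarrow>\<^sub>E D" if "b \<in> ans2 ?Rk (ask2 ?Rk r)" for b
      using that repeated_game_supportD[OF r] by (auto simp: PiE_iff intro!: ev2)
    moreover have "wins ?Rk r a b \<longleftrightarrow>
      (\<forall>i<k. V (r i) ((\<lambda>i\<in>{..<k}. ev1 (r i) (a i)) i) ((\<lambda>i\<in>{..<k}. ev2 (r i) (b i)) i))" for a b
      by (simp add: wins)
    ultimately show ?thesis unfolding accepted_def T_def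
      by (rule accepted_image[where Q = "\<lambda>\<alpha> \<beta>. \<forall>i<k. V (r i) (\<alpha> i) (\<beta> i)"
          and u = "\<lambda>a. \<lambda>i\<in>{..<k}. ev1 (r i) (a i)" and v = "\<lambda>b. \<lambda>i\<in>{..<k}. ev2 (r i) (b i)"])
  qed
  have fibres: "(\<Sum>(a, b)\<in>accepted ?Rk r. \<phi> (f a) (h b)) = (\<Sum>(\<alpha>, \<beta>)\<in>T r.
      \<phi> (\<Sum>a | a \<in> (\<Pi>\<^sub>E i\<in>{..<k}. ans1 R (ask1 ?Rk r i)) \<and> (\<lambda>i\<in>{..<k}. ev1 (r i) (a i)) = \<alpha>. f a)
        (\<Sum>b | b \<in> (\<Pi>\<^sub>E i\<in>{..<k}. ans2 R (ask2 ?Rk r i)) \<and> (\<lambda>i\<in>{..<k}. ev2 (r i) (b i)) = \<beta>. h b))"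
    if r: "r \<in> set_pmf (referee ?Rk)" for r f h
  proof -
    have "finite (ans1 ?Rk (ask1 ?Rk r))" "finite (ans2 ?Rk (ask2 ?Rk r))"
      using finite_gameD[OF Rk] r by blast+
    from sum_fibres[OF this finT[of r], of f "\<lambda>a. \<lambda>i\<in>{..<k}. ev1 (r i) (a i)" h "\<lambda>b. \<lambda>i\<in>{..<k}. ev2 (r i) (b i)"]
    show ?thesis unfolding acc[OF r] by (simp only: repeated_game_simps)
  qed
  have upd: "ask1 (repeated_game (Suc k) R) (r(k := s)) = (ask1 ?Rk r)(k := ask1 R s)"
    "ask2 (repeated_game (Suc k) R) (r(k := s)) = (ask2 ?Rk r)(k := ask2 R s)" for r s
    by (simp_all only: repeated_game_simps restrict_Suc_upd)
  have "game_value (repeated_game (Suc k) R) F H =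
      ?Ek (\<lambda>r. ?E (\<lambda>s. \<Sum>(a, b)\<in>accepted ?Rk r. \<Sum>(a0, b0)\<in>accepted R s.
        \<phi> (F ((ask1 ?Rk r)(k := ask1 R s)) (a(k := a0))) (H ((ask2 ?Rk r)(k := ask2 R s)) (b(k := b0)))))"
    unfolding game_value_def expectation_repeated_Suc[OF R] upd sum_accepted_Suc ..
  also have "\<dots> = ?Ek (\<lambda>r. \<Sum>(\<alpha>, \<beta>)\<in>T r. game_value R (F' r \<alpha>) (H' r \<beta>))"
  proof (rule expectation_cong[OF fink])
    fix r assume r: "r \<in> set_pmf (referee ?Rk)"
    have "(\<Sum>(a, b)\<in>accepted ?Rk r. \<Sum>(a0, b0)\<in>accepted R s.
        \<phi> (F ((ask1 ?Rk r)(k := ask1 R s)) (a(k := a0))) (H ((ask2 ?Rk r)(k := ask2 R s)) (b(k := b0)))) =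
      (\<Sum>(\<alpha>, \<beta>)\<in>T r. \<Sum>(a0, b0)\<in>accepted R s. \<phi> (F' r \<alpha> (ask1 R s) a0) (H' r \<beta> (ask2 R s) b0))" for s
    proof -
      have "(\<Sum>(a, b)\<in>accepted ?Rk r. \<Sum>(a0, b0)\<in>accepted R s.
          \<phi> (F ((ask1 ?Rk r)(k := ask1 R s)) (a(k := a0))) (H ((ask2 ?Rk r)(k := ask2 R s)) (b(k := b0)))) =
        (\<Sum>(a0, b0)\<in>accepted R s. \<Sum>(a, b)\<in>accepted ?Rk r.
          \<phi> (F ((ask1 ?Rk r)(k := ask1 R s)) (a(k := a0))) (H ((ask2 ?Rk r)(k := ask2 R s)) (b(k := b0))))"
        unfolding case_prod_unfold by (rule sum.swap)
      also have "\<dots> = (\<Sum>(a0, b0)\<in>accepted R s. \<Sum>(\<alpha>, \<beta>)\<in>T r.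
          \<phi> (F' r \<alpha> (ask1 R s) a0) (H' r \<beta> (ask2 R s) b0))"
        unfolding fibres[OF r] F'_def H'_def conditioned_def ..
      also have "\<dots> = (\<Sum>(\<alpha>, \<beta>)\<in>T r. \<Sum>(a0, b0)\<in>accepted R s.
          \<phi> (F' r \<alpha> (ask1 R s) a0) (H' r \<beta> (ask2 R s) b0))"
        unfolding case_prod_unfold by (rule sum.swap)
      finally show ?thesis .
    qed
    then show "?E (\<lambda>s. \<Sum>(a, b)\<in>accepted ?Rk r. \<Sum>(a0, b0)\<in>accepted R s.
        \<phi> (F ((ask1 ?Rk r)(k := ask1 R s)) (a(k := a0))) (H ((ask2 ?Rk r)(k := ask2 R s)) (b(k := b0)))) =
      (\<Sum>(\<alpha>, \<beta>)\<in>T r. game_value R (F' r \<alpha>) (H' r \<beta>))"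
      by (simp add: game_value_def case_prod_unfold expectation_sum[OF fin])
  qed
  also have "\<dots> \<le> ?Ek (\<lambda>r. c * (\<Sum>(\<alpha>, \<beta>)\<in>T r. mass R (F' r \<alpha>) (H' r \<beta>)) + \<delta> * real (card C * card D) ^ k)"
  proof (rule expectation_mono[OF fink])
    fix r assume r: "r \<in> set_pmf (referee ?Rk)"
    have q: "ask1 ?Rk r \<in> {..<k} \<rightarrow>\<^sub>E quest1 R" "ask2 ?Rk r \<in> {..<k} \<rightarrow>\<^sub>E quest2 R"
      using finite_gameD(2,3)[OF Rk r] by (simp_all only: repeated_game_simps)
    have "(\<Sum>(\<alpha>, \<beta>)\<in>T r. game_value R (F' r \<alpha>) (H' r \<beta>)) \<le>
        (\<Sum>(\<alpha>, \<beta>)\<in>T r. c * mass R (F' r \<alpha>) (H' r \<beta>) + \<delta>)"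
    proof (rule sum_mono, clarify)
      fix \<alpha> \<beta>
      show "game_value R (F' r \<alpha>) (H' r \<beta>) \<le> c * mass R (F' r \<alpha>) (H' r \<beta>) + \<delta>"
        unfolding F'_def H'_def
        by (intro fortified subPOVM_conditioned q finite_gameD(4,5)[OF R]
            F[unfolded repeated_game_simps] H[unfolded repeated_game_simps])
    qed
    also have "\<dots> = c * (\<Sum>(\<alpha>, \<beta>)\<in>T r. mass R (F' r \<alpha>) (H' r \<beta>)) + \<delta> * card (T r)"
      by (simp add: case_prod_unfold sum.distrib sum_distrib_left mult.commute)
    also have "\<dots> \<le> c * (\<Sum>(\<alpha>, \<beta>)\<in>T r. mass R (F' r \<alpha>) (H' r \<beta>)) + \<delta> * real (card C * card D) ^ k"
      by (intro add_left_mono mult_left_mono cardT nn)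
    finally show "(\<Sum>(\<alpha>, \<beta>)\<in>T r. game_value R (F' r \<alpha>) (H' r \<beta>)) \<le>
      c * (\<Sum>(\<alpha>, \<beta>)\<in>T r. mass R (F' r \<alpha>) (H' r \<beta>)) + \<delta> * real (card C * card D) ^ k" .
  qed
  also have "\<dots> = c * ?Ek (\<lambda>r. \<Sum>(\<alpha>, \<beta>)\<in>T r. mass R (F' r \<alpha>) (H' r \<beta>)) + \<delta> * real (card C * card D) ^ k"
    using fink by (subst Bochner_Integration.integral_add) (auto intro: integrable_measure_pmf_finite)
  \<comment> \<open>The masses are sums of \<phi> over blocks of the marginals;
    \<open>fibres\<close> read backwards joins the blocks into the accepted pairs of the first
    \<open>k\<close> rounds.\<close>
  also have "?Ek (\<lambda>r. \<Sum>(\<alpha>, \<beta>)\<in>T r. mass R (F' r \<alpha>) (H' r \<beta>)) =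
      ?Ek (\<lambda>r. ?E (\<lambda>s. \<Sum>(a, b)\<in>accepted ?Rk r.
        \<phi> (marginal k (ans1 R) (ask1 R s) F (ask1 ?Rk r) a) (marginal k (ans2 R) (ask2 R s) H (ask2 ?Rk r) b)))"
  proof (rule expectation_cong[OF fink])
    fix r assume r: "r \<in> set_pmf (referee ?Rk)"
    have "(\<Sum>(\<alpha>, \<beta>)\<in>T r. mass R (F' r \<alpha>) (H' r \<beta>)) = ?E (\<lambda>s. \<Sum>(\<alpha>, \<beta>)\<in>T r.
        \<phi> (\<Sum>a\<in>ans1 R (ask1 R s). F' r \<alpha> (ask1 R s) a) (\<Sum>b\<in>ans2 R (ask2 R s). H' r \<beta> (ask2 R s) b))"
      by (simp add: mass_def case_prod_unfold expectation_sum[OF fin])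
    then show "(\<Sum>(\<alpha>, \<beta>)\<in>T r. mass R (F' r \<alpha>) (H' r \<beta>)) =
      ?E (\<lambda>s. \<Sum>(a, b)\<in>accepted ?Rk r.
        \<phi> (marginal k (ans1 R) (ask1 R s) F (ask1 ?Rk r) a) (marginal k (ans2 R) (ask2 R s) H (ask2 ?Rk r) b))"
      unfolding F'_def H'_def sum_conditioned fibres[OF r] .
  qed
  \<comment> \<open>With the sample \<open>s\<close> of the last round outside, both marginals are
    complete strategies for \<open>k\<close> rounds, and \<open>bound\<close> applies to each
    \<open>s\<close> separately.\<close>
  also have "\<dots> = ?E (\<lambda>s. game_value ?Rk (marginal k (ans1 R) (ask1 R s) F) (marginal k (ans2 R) (ask2 R s) H))"
    unfolding game_value_def by (rule expectation_swap[OF fink fin])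
  also have "c * \<dots> \<le> c * w"
  proof (intro mult_left_mono nn expectation_le_const fin bound)
    fix s assume s: "s \<in> set_pmf (referee R)"
    show "POVM (quest1 ?Rk) (ans1 ?Rk) (marginal k (ans1 R) (ask1 R s) F)"
      using POVM_marginal[OF F[unfolded repeated_game_simps] finite_gameD(2)[OF R s]]
      by (simp only: repeated_game_simps)
    show "POVM (quest2 ?Rk) (ans2 ?Rk) (marginal k (ans2 R) (ask2 R s) H)"
      using POVM_marginal[OF H[unfolded repeated_game_simps] finite_gameD(3)[OF R s]]
      by (simp only: repeated_game_simps)
  qed
  finally show ?thesis by simp
qed

end

section \<open>Concatenated games\<close>

lemma concat_game_simps [simp]:
  "referee (concat_game X' M G Y' P) = (qdist G \<bind> (\<lambda>(x, y). pmf_of_set (M\<inverse> `` {x}) \<bind>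
     (\<lambda>x'. pmf_of_set (P\<inverse> `` {y}) \<bind> (\<lambda>y'. return_pmf (x, y, x', y')))))"
  "quest1 (concat_game X' M G Y' P) = X'"
  "quest2 (concat_game X' M G Y' P) = Y'"
  "ask1 (concat_game X' M G Y' P) (x, y, x', y') = x'"
  "ask2 (concat_game X' M G Y' P) (x, y, x', y') = y'"
  "ans1 (concat_game X' M G Y' P) = (\<lambda>x'. (M `` {x'}) \<rightarrow>\<^sub>E ansA G)"
  "ans2 (concat_game X' M G Y' P) = (\<lambda>y'. (P `` {y'}) \<rightarrow>\<^sub>E ansB G)"
  "wins (concat_game X' M G Y' P) (x, y, x', y') a' b' \<longleftrightarrow> accepts G (a' x) (b' y) x y"
  by (simp_all add: concat_game_def)

lemma plain_simps [simp]:
  "referee (plain G) = qdist G"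
  "quest1 (plain G) = questX G"
  "quest2 (plain G) = questY G"
  "ask1 (plain G) r = fst r"
  "ask2 (plain G) r = snd r"
  "ans1 (plain G) = (\<lambda>_. ansA G)"
  "ans2 (plain G) = (\<lambda>_. ansB G)"
  "wins (plain G) (x, y) a b \<longleftrightarrow> accepts G a b x y"
  by (simp_all add: plain_def)

lemma is_gameD:
  assumes "is_game G"
  shows "finite (set_pmf (qdist G))" "finite (ansA G)" "finite (ansB G)"
    and "(x, y) \<in> set_pmf (qdist G) \<Longrightarrow> x \<in> questX G"
    and "(x, y) \<in> set_pmf (qdist G) \<Longrightarrow> y \<in> questY G"
  using assms by (auto simp: is_game_def intro: finite_subset[of _ "questX G \<times> questY G"])

lemma is_bipartite_graphD:
  assumes "is_bipartite_graph E X' X"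
  shows "finite (E\<inverse> `` {x})" "finite (E `` {x'})"
    and "x \<in> X \<Longrightarrow> E\<inverse> `` {x} \<noteq> {}" "E\<inverse> `` {x} \<subseteq> X'"
proof -
  have E: "finite X'" "finite X" "E \<subseteq> X' \<times> X" using assms by (auto simp: is_bipartite_graph_def)
  show "E\<inverse> `` {x} \<subseteq> X'" using E(3) by auto
  then show "finite (E\<inverse> `` {x})" using E(1) by (rule finite_subset)
  have "E `` {x'} \<subseteq> X" using E(3) by auto
  then show "finite (E `` {x'})" using E(2) by (rule finite_subset)
  show "x \<in> X \<Longrightarrow> E\<inverse> `` {x} \<noteq> {}" using assms by (auto simp: is_bipartite_graph_def)
qed

lemma finite_plain_game: "is_game G \<Longrightarrow> finite_game (plain G)"
  by (auto simp: finite_game_def is_gameD)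

text \<open>\<open>pmf_of_set\<close> has the intended support only on nonempty finite sets;
  neighbourhoods of questions in the support of \<open>qdist G\<close> are such.\<close>

lemma set_referee_concat:
  assumes G: "is_game G" and M: "is_bipartite_graph M X' (questX G)"
    and P: "is_bipartite_graph P Y' (questY G)"
  shows "set_pmf (referee (concat_game X' M G Y' P)) =
    (\<Union>(x, y)\<in>set_pmf (qdist G). \<Union>x'\<in>M\<inverse> `` {x}. \<Union>y'\<in>P\<inverse> `` {y}. {(x, y, x', y')})"
  unfolding concat_game_simps set_bind_pmf[of "qdist G"]
proof (intro SUP_cong refl)
  fix z assume "z \<in> set_pmf (qdist G)"
  moreover obtain x y where z: "z = (x, y)" by (cases z)
  ultimately have "x \<in> questX G" "y \<in> questY G" using is_gameD[OF G] by auto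
  then have "set_pmf (pmf_of_set (M\<inverse> `` {x})) = M\<inverse> `` {x}" "set_pmf (pmf_of_set (P\<inverse> `` {y})) = P\<inverse> `` {y}"
    using is_bipartite_graphD[OF M] is_bipartite_graphD[OF P] by (auto intro!: set_pmf_of_set)
  then show "set_pmf (case z of (x, y) \<Rightarrow> pmf_of_set (M\<inverse> `` {x}) \<bind>
      (\<lambda>x'. pmf_of_set (P\<inverse> `` {y}) \<bind> (\<lambda>y'. return_pmf (x, y, x', y')))) =
    (case z of (x, y) \<Rightarrow> \<Union>x'\<in>M\<inverse> `` {x}. \<Union>y'\<in>P\<inverse> `` {y}. {(x, y, x', y')})"
    by (simp add: z set_bind_pmf)
qed

lemma finite_concat_game:
  assumes "is_game G" "is_bipartite_graph M X' (questX G)" "is_bipartite_graph P Y' (questY G)"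
  shows "finite_game (concat_game X' M G Y' P)"
  unfolding finite_game_def set_referee_concat[OF assms]
  using is_gameD[OF assms(1)] is_bipartite_graphD[OF assms(2)] is_bipartite_graphD[OF assms(3)]
  by (force simp: intro!: finite_PiE)

lemma expectation_concat:
  fixes h :: "_ \<Rightarrow> real"
  assumes G: "is_game G" and M: "is_bipartite_graph M X' (questX G)"
    and P: "is_bipartite_graph P Y' (questY G)"
  shows "measure_pmf.expectation (referee (concat_game X' M G Y' P)) h =
    measure_pmf.expectation (qdist G) (\<lambda>(x, y).
      (\<Sum>x'\<in>M\<inverse> `` {x}. \<Sum>y'\<in>P\<inverse> `` {y}. h (x, y, x', y')) / (card (M\<inverse> `` {x}) * card (P\<inverse> `` {y})))"
proof -
  have N: "M\<inverse> `` {x} \<noteq> {}" "finite (M\<inverse> `` {x})" "P\<inverse> `` {y} \<noteq> {}" "finite (P\<inverse> `` {y})"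
    if "(x, y) \<in> set_pmf (qdist G)" for x y
    using that is_gameD[OF G] is_bipartite_graphD[OF M] is_bipartite_graphD[OF P] by blast+
  have fin1: "finite (set_pmf (pmf_of_set (P\<inverse> `` {y}) \<bind> (\<lambda>y'. return_pmf (x, y, x', y'))))"
    if "(x, y) \<in> set_pmf (qdist G)" for x y x'
    using N[OF that] by (simp add: set_bind_pmf)
  have fin2: "finite (set_pmf (pmf_of_set (M\<inverse> `` {x}) \<bind> (\<lambda>x'. pmf_of_set (P\<inverse> `` {y}) \<bind>
      (\<lambda>y'. return_pmf (x, y, x', y')))))" if "(x, y) \<in> set_pmf (qdist G)" for x y
    using N[OF that] by (simp add: set_bind_pmf)
  have inner: "measure_pmf.expectation (pmf_of_set (M\<inverse> `` {x}) \<bind> (\<lambda>x'. pmf_of_set (P\<inverse> `` {y}) \<bind>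
      (\<lambda>y'. return_pmf (x, y, x', y')))) h =
      (\<Sum>x'\<in>M\<inverse> `` {x}. \<Sum>y'\<in>P\<inverse> `` {y}. h (x, y, x', y')) / (card (M\<inverse> `` {x}) * card (P\<inverse> `` {y}))"
    if xy: "(x, y) \<in> set_pmf (qdist G)" for x y
    using N[OF xy] fin1[OF xy]
    by (subst expectation_bind)
      (simp_all add: expectation_bind integral_pmf_of_set sum_divide_distrib mult_ac)
  show ?thesis
    unfolding concat_game_simps
  proof (subst expectation_bind)
    show "finite (set_pmf (qdist G))" by (rule is_gameD(1)[OF G])
    then show "measure_pmf.expectation (qdist G) (\<lambda>z. measure_pmf.expectation (case z of (x, y) \<Rightarrow>
        pmf_of_set (M\<inverse> `` {x}) \<bind> (\<lambda>x'. pmf_of_set (P\<inverse> `` {y}) \<bind>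
          (\<lambda>y'. return_pmf (x, y, x', y')))) h) =
      measure_pmf.expectation (qdist G) (\<lambda>(x, y).
        (\<Sum>x'\<in>M\<inverse> `` {x}. \<Sum>y'\<in>P\<inverse> `` {y}. h (x, y, x', y')) / (card (M\<inverse> `` {x}) * card (P\<inverse> `` {y})))"
      by (rule expectation_cong) (auto simp only: split: prod.split intro!: inner)
  qed (auto simp only: split: prod.split intro!: fin2)
qed

section \<open>Induced strategies for the inner game\<close>

text \<open>The uniform average is written as a scaled sum so that values may lie in any real vector
  space. \<open>induced_classical_eq\<close> and \<open>mat_sum_induced_quantum\<close> connect it
  with the two notions used in weak fortification.\<close>

definition induced ::
    "('x1 \<times> 'x) set \<Rightarrow> 'a set \<Rightarrow> ('x1 \<Rightarrow> ('x \<Rightarrow> 'a) \<Rightarrow> 'u::real_vector) \<Rightarrow> 'x \<Rightarrow> 'a \<Rightarrow> 'u" where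
  "induced E S F x a = (1 / card (E\<inverse> `` {x})) *\<^sub>R
     (\<Sum>x'\<in>E\<inverse> `` {x}. \<Sum>a' | a' \<in> (E `` {x'}) \<rightarrow>\<^sub>E S \<and> a' x = a. F x' a')"

text \<open>A neighbour x' of x has x in N(x'), so \<open>a' x\<close> lies in \<open>S\<close> and
  the classes \<open>a' x = a\<close> partition the maps.\<close>

lemma sum_induced:
  assumes E: "is_bipartite_graph E X' X" and S: "finite S"
  shows "(\<Sum>a\<in>S. induced E S F x a) = (1 / card (E\<inverse> `` {x})) *\<^sub>R
     (\<Sum>x'\<in>E\<inverse> `` {x}. \<Sum>a'\<in>(E `` {x'}) \<rightarrow>\<^sub>E S. F x' a')"
proof -
  have "(\<Sum>a\<in>S. \<Sum>a' | a' \<in> (E `` {x'}) \<rightarrow>\<^sub>E S \<and> a' x = a. F x' a') =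
      (\<Sum>a'\<in>(E `` {x'}) \<rightarrow>\<^sub>E S. F x' a')" if "x' \<in> E\<inverse> `` {x}" for x'
    using that S is_bipartite_graphD(2)[OF E] by (intro sum.group finite_PiE) (auto simp: PiE_iff)
  moreover have "(\<Sum>a\<in>S. induced E S F x a) = (1 / card (E\<inverse> `` {x})) *\<^sub>R
      (\<Sum>a\<in>S. \<Sum>x'\<in>E\<inverse> `` {x}. \<Sum>a' | a' \<in> (E `` {x'}) \<rightarrow>\<^sub>E S \<and> a' x = a. F x' a')"
    unfolding induced_def by (rule scaleR_sum_right[symmetric])
  ultimately show ?thesis
    by (subst (asm) sum.swap) simp
qed

context correlation begin

lemma POVM_induced:
  assumes E: "is_bipartite_graph E X' X" and S: "finite S"
    and F: "POVM X' (\<lambda>x'. (E `` {x'}) \<rightarrow>\<^sub>E S) F"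
  shows "POVM X (\<lambda>_. S) (induced E S F)"
  unfolding POVM_def
proof (intro ballI conjI)
  fix x assume x: "x \<in> X"
  show "induced E S F x a \<in> K" for a
    unfolding induced_def using is_bipartite_graphD(4)[OF E]
    by (intro scale_K sum_K POVM_D(1)[OF F]) auto
  have "(\<Sum>x'\<in>E\<inverse> `` {x}. \<Sum>a'\<in>(E `` {x'}) \<rightarrow>\<^sub>E S. F x' a') = (\<Sum>x'\<in>E\<inverse> `` {x}. e)"
    using is_bipartite_graphD(4)[OF E] POVM_D(2)[OF F] by (intro sum.cong) auto
  then show "(\<Sum>a\<in>S. induced E S F x a) = e"
    using is_bipartite_graphD(1,3)[OF E] x
    by (simp add: sum_induced[OF E S] sum_constant_scaleR card_gt_0_iff)
qed

lemma \<phi>_scale: "\<phi> (r *\<^sub>R u) (s *\<^sub>R v) = r * s * \<phi> u v"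
  by (simp add: bilinear_lmul[OF bilinear] bilinear_rmul[OF bilinear])

text \<open>Given (x, y), the neighbours x' and y' are independent, so by bilinearity the average of
  \<phi> is \<phi> of the averages.\<close>

lemma mass_concat:
  assumes G: "is_game G" and M: "is_bipartite_graph M X' (questX G)"
    and P: "is_bipartite_graph P Y' (questY G)"
  shows "mass (concat_game X' M G Y' P) F H = measure_pmf.expectation (qdist G) (\<lambda>(x, y).
    \<phi> (\<Sum>a\<in>ansA G. induced M (ansA G) F x a) (\<Sum>b\<in>ansB G. induced P (ansB G) H y b))"
  unfolding mass_def expectation_concat[OF assms]
  by (simp add: sum_induced[OF M is_gameD(2)[OF G]] sum_induced[OF P is_gameD(3)[OF G]]
      \<phi>_scale \<phi>_sum[of _ "M\<inverse> `` _" _ "P\<inverse> `` _"])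

text \<open>The same independence applied block by block: maps are grouped by a'(x) and b'(y), the
  only values the verdict uses. It supplies the bound for one round, as complete strategies induce
  complete ones.\<close>

lemma game_value_concat:
  assumes G: "is_game G" and M: "is_bipartite_graph M X' (questX G)"
    and P: "is_bipartite_graph P Y' (questY G)"
  shows "game_value (concat_game X' M G Y' P) F H =
    game_value (plain G) (induced M (ansA G) F) (induced P (ansB G) H)"
proof -
  let ?R = "concat_game X' M G Y' P"
  let ?N = "\<lambda>x. M\<inverse> `` {x}" and ?N' = "\<lambda>y. P\<inverse> `` {y}"
  have "(\<Sum>(a, b)\<in>accepted (plain G) (x, y). \<phi> (induced M (ansA G) F x a) (induced P (ansB G) H y b)) =
      (\<Sum>x'\<in>?N x. \<Sum>y'\<in>?N' y. \<Sum>(a, b)\<in>accepted ?R (x, y, x', y'). \<phi> (F x' a) (H y' b)) /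
        (card (?N x) * card (?N' y))" for x y
  proof -
    have "(\<Sum>(a, b)\<in>accepted (plain G) (x, y).
        \<phi> (\<Sum>a' | a' \<in> (M `` {x'}) \<rightarrow>\<^sub>E ansA G \<and> a' x = a. F x' a')
          (\<Sum>b' | b' \<in> (P `` {y'}) \<rightarrow>\<^sub>E ansB G \<and> b' y = b. H y' b')) =
      (\<Sum>(a, b)\<in>accepted ?R (x, y, x', y'). \<phi> (F x' a) (H y' b))"
      if "x' \<in> ?N x" "y' \<in> ?N' y" for x' y'
    proof -
      have "finite (accepted (plain G) (x, y))"
        using is_gameD[OF G] by (auto simp: accepted_def intro: finite_subset[of _ "ansA G \<times> ansB G"])
      moreover have "finite ((M `` {x'}) \<rightarrow>\<^sub>E ansA G)" "finite ((P `` {y'}) \<rightarrow>\<^sub>E ansB G)"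
        using is_gameD[OF G] is_bipartite_graphD[OF M] is_bipartite_graphD[OF P]
        by (auto intro!: finite_PiE)
      moreover have "accepted ?R (x, y, x', y') = {(a, b) \<in> ((M `` {x'}) \<rightarrow>\<^sub>E ansA G) \<times> ((P `` {y'}) \<rightarrow>\<^sub>E ansB G).
          (a x, b y) \<in> accepted (plain G) (x, y)}"
        using that by (auto simp: accepted_def PiE_iff)
      ultimately show ?thesis by (simp only: sum_fibres)
    qed
    then have "(\<Sum>x'\<in>?N x. \<Sum>y'\<in>?N' y. \<Sum>(a, b)\<in>accepted ?R (x, y, x', y'). \<phi> (F x' a) (H y' b)) =
      (\<Sum>x'\<in>?N x. \<Sum>y'\<in>?N' y. \<Sum>(a, b)\<in>accepted (plain G) (x, y).
        \<phi> (\<Sum>a' | a' \<in> (M `` {x'}) \<rightarrow>\<^sub>E ansA G \<and> a' x = a. F x' a')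
          (\<Sum>b' | b' \<in> (P `` {y'}) \<rightarrow>\<^sub>E ansB G \<and> b' y = b. H y' b'))" by simp
    also have "\<dots> = (\<Sum>(a, b)\<in>accepted (plain G) (x, y). \<Sum>x'\<in>?N x. \<Sum>y'\<in>?N' y.
        \<phi> (\<Sum>a' | a' \<in> (M `` {x'}) \<rightarrow>\<^sub>E ansA G \<and> a' x = a. F x' a')
          (\<Sum>b' | b' \<in> (P `` {y'}) \<rightarrow>\<^sub>E ansB G \<and> b' y = b. H y' b'))"
      by (simp only: case_prod_unfold sum.swap[of _ _ "accepted (plain G) (x, y)"])
    finally show ?thesis
      unfolding induced_def \<phi>_scale
      by (simp add: \<phi>_sum[of _ "M\<inverse> `` _" _ "P\<inverse> `` _"] case_prod_unfold sum_divide_distrib)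
  qed
  then have "(\<lambda>r. \<Sum>(a, b)\<in>accepted (plain G) r. \<phi> (induced M (ansA G) F (fst r) a) (induced P (ansB G) H (snd r) b)) =
      (\<lambda>(x, y). (\<Sum>x'\<in>?N x. \<Sum>y'\<in>?N' y. \<Sum>(a, b)\<in>accepted ?R (x, y, x', y'). \<phi> (F x' a) (H y' b)) /
        (card (?N x) * card (?N' y)))"
    by (intro ext) (simp only: split_paired_all fst_conv snd_conv prod.case)
  then show ?thesis
    unfolding game_value_def expectation_concat[OF assms] by simp
qed

end

section \<open>Induction on the number of rounds\<close>

context correlation begin

lemma POVM_single_round:
  assumes F: "POVM ({..<Suc 0} \<rightarrow>\<^sub>E Q) (\<lambda>q. \<Pi>\<^sub>E i\<in>{..<Suc 0}. S (q i)) F"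
  shows "POVM Q S (\<lambda>x a. F ((\<lambda>_. undefined)(0 := x)) ((\<lambda>_. undefined)(0 := a)))"
  unfolding POVM_def
proof (intro ballI conjI)
  let ?u = "\<lambda>_. undefined"
  fix x assume x: "x \<in> Q"
  then have q: "?u(0 := x) \<in> {..<Suc 0} \<rightarrow>\<^sub>E Q" by (intro PiE_upd_Suc) auto
  show "F (?u(0 := x)) (?u(0 := a)) \<in> K" if "a \<in> S x" for a
    by (intro POVM_D(1)[OF F q] upd_PiE_Suc that) auto
  show "(\<Sum>a\<in>S x. F (?u(0 := x)) (?u(0 := a))) = e"
    using POVM_D(2)[OF F q] unfolding sum_upd_Suc by (simp add: fun_upd_def)
qed

lemma game_value_single_round:
  assumes R: "finite_game R"
  shows "game_value (repeated_game (Suc 0) R) F H =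
    game_value R (\<lambda>x a. F ((\<lambda>_. undefined)(0 := x)) ((\<lambda>_. undefined)(0 := a)))
      (\<lambda>y b. H ((\<lambda>_. undefined)(0 := y)) ((\<lambda>_. undefined)(0 := b)))"
proof -
  \<comment> \<open>With zero rounds there is one tuple for each player and winning is vacuous, so
    splitting off the last of one round leaves \<open>R\<close>.\<close>
  have "accepted (repeated_game 0 R) r = {(\<lambda>_. undefined, \<lambda>_. undefined)}" for r
    by (auto simp: accepted_def)
  then show ?thesis
    unfolding game_value_def expectation_repeated_Suc[OF R] sum_accepted_Suc
    by (simp add: restrict_Suc_0_upd del: fun_upd_apply)
qed

text \<open>\<open>v\<close> stands for the value of \<open>G\<close> and \<open>c\<close> for
  Val(G) + \<epsilon>. Both bounds are assumed only for the form \<phi> at hand, in the quantum case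
  for one fixed state.\<close>

lemma game_value_repeated_concat_le:
  assumes G: "is_game G" and M: "is_bipartite_graph M X' (questX G)"
    and P: "is_bipartite_graph P Y' (questY G)"
    and m: "1 \<le> m" and nn: "0 \<le> v" "v \<le> c" "0 \<le> \<delta>"
    and inner: "\<And>F H. POVM (questX G) (\<lambda>_. ansA G) F \<Longrightarrow> POVM (questY G) (\<lambda>_. ansB G) H \<Longrightarrow>
      game_value (plain G) F H \<le> v"
    and fortified: "\<And>F H.
      subPOVM X' (\<lambda>x'. (M `` {x'}) \<rightarrow>\<^sub>E ansA G) F \<Longrightarrow> subPOVM Y' (\<lambda>y'. (P `` {y'}) \<rightarrow>\<^sub>E ansB G) H \<Longrightarrow>
      game_value (concat_game X' M G Y' P) F H \<le> c * measure_pmf.expectation (qdist G) (\<lambda>(x, y).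
        \<phi> (\<Sum>a\<in>ansA G. induced M (ansA G) F x a) (\<Sum>b\<in>ansB G. induced P (ansB G) H y b)) + \<delta>"
    and F: "POVM (quest1 (repeated_game m (concat_game X' M G Y' P)))
      (ans1 (repeated_game m (concat_game X' M G Y' P))) F"
    and H: "POVM (quest2 (repeated_game m (concat_game X' M G Y' P)))
      (ans2 (repeated_game m (concat_game X' M G Y' P))) H"
  shows "game_value (repeated_game m (concat_game X' M G Y' P)) F H \<le>
    c ^ m + \<delta> * (real m - 1) * real (card (ansA G) * card (ansB G)) ^ (m - 1)"
proof (cases "1 \<le> c")
  \<comment> \<open>For \<open>c \<ge> 1\<close> the recursion would amplify the error term, but then the claim is trivial.\<close>
  case True
  let ?R = "concat_game X' M G Y' P"
  have "game_value (repeated_game m ?R) F H \<le> 1"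
    by (intro game_value_le_1 finite_repeated_game finite_concat_game G M P F H)
  also have "1 \<le> c ^ m" using True by simp
  finally show ?thesis using m nn(3) by (simp add: add_increasing2)
next
  case c: False
  let ?R = "concat_game X' M G Y' P" and ?s = "real (card (ansA G) * card (ansB G))"
  have c0: "0 \<le> c" using nn by simp
  note R = finite_concat_game[OF G M P]
  note concat = concat_game_simps(1-3,6,7)
  show ?thesis using m F H
  proof (induction m arbitrary: F H rule: nat_induct_at_least)
    \<comment> \<open>For one round the factor \<open>real m - 1\<close> removes the error term, so
      the bound comes from \<open>v \<le> c\<close>; fortification would cost an extra
      \<delta>.\<close>
    case base
    let ?F = "\<lambda>x a. F ((\<lambda>_. undefined)(0 := x)) ((\<lambda>_. undefined)(0 := a))"
    let ?H = "\<lambda>y b. H ((\<lambda>_. undefined)(0 := y)) ((\<lambda>_. undefined)(0 := b))"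
    have "POVM X' (\<lambda>x'. (M `` {x'}) \<rightarrow>\<^sub>E ansA G) ?F"
      using base(1) unfolding One_nat_def repeated_game_simps concat by (rule POVM_single_round)
    moreover have "POVM Y' (\<lambda>y'. (P `` {y'}) \<rightarrow>\<^sub>E ansB G) ?H"
      using base(2) unfolding One_nat_def repeated_game_simps concat by (rule POVM_single_round)
    ultimately have "game_value ?R ?F ?H \<le> v"
      unfolding game_value_concat[OF G M P]
      by (intro inner POVM_induced[OF M] POVM_induced[OF P] is_gameD[OF G])
    then have "game_value (repeated_game 1 ?R) F H \<le> v"
      unfolding One_nat_def game_value_single_round[OF R] .
    then show ?case using nn by simp
  next
    case (Suc k)
    have "game_value (repeated_game (Suc k) ?R) F H \<le>
        c * (c ^ k + \<delta> * (real k - 1) * ?s ^ (k - 1)) + \<delta> * ?s ^ k"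
    proof (rule game_value_Suc_le[OF R Suc.prems is_gameD(2,3)[OF G]])
      let ?ev1 = "\<lambda>(x, y, x', y') a. a x" and ?ev2 = "\<lambda>(x, y, x', y') b. b y"
      show "?ev1 r a \<in> ansA G" if "r \<in> set_pmf (referee ?R)" "a \<in> ans1 ?R (ask1 ?R r)" for r a
        using that unfolding set_referee_concat[OF G M P] by (auto simp: PiE_iff)
      show "?ev2 r b \<in> ansB G" if "r \<in> set_pmf (referee ?R)" "b \<in> ans2 ?R (ask2 ?R r)" for r b
        using that unfolding set_referee_concat[OF G M P] by (auto simp: PiE_iff)
      show "wins ?R r a b \<longleftrightarrow> (\<lambda>(x, y, x', y') a b. accepts G a b x y) r (?ev1 r a) (?ev2 r b)" for r a b
        by (cases r) simp
      show "game_value ?R F H \<le> c * mass ?R F H + \<delta>"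
        if "subPOVM (quest1 ?R) (ans1 ?R) F" "subPOVM (quest2 ?R) (ans2 ?R) H" for F H
        using fortified[of F H] that unfolding mass_concat[OF G M P] concat by simp
    qed (use Suc.IH c0 nn in auto)
    also have "\<dots> = c ^ Suc k + c * (\<delta> * (real k - 1) * ?s ^ (k - 1)) + \<delta> * ?s ^ k"
      by (simp add: algebra_simps)
    \<comment> \<open>Here \<open>c < 1\<close> absorbs the factor that the recursion puts on the
      earlier error.\<close>
    also have "c * (\<delta> * (real k - 1) * ?s ^ (k - 1)) \<le> 1 * (\<delta> * (real k - 1) * ?s ^ (k - 1))"
      using c nn \<open>1 \<le> k\<close> by (intro mult_right_mono) auto
    also have "\<dots> \<le> \<delta> * (real k - 1) * ?s ^ k"
    \<comment> \<open>Raising the exponent needs \<open>?s \<ge> 1\<close>. For \<open>k = 1\<close>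
      the factor \<open>real k - 1\<close> is zero; for \<open>?s = 0\<close> and
      \<open>k \<ge> 2\<close> both powers vanish.\<close>
    proof (cases "k = 1 \<or> card (ansA G) * card (ansB G) = 0")
      case True
      then show ?thesis using nn \<open>1 \<le> k\<close> by (cases "k = 1") (auto simp: power_0_left)
    next
      case False
      then have "1 \<le> card (ansA G) * card (ansB G)" by (simp add: Suc_le_eq)
      then have "1 \<le> ?s" by (rule of_nat_le_iff[THEN iffD2, of 1, simplified of_nat_1])
      then have "?s ^ (k - 1) \<le> ?s ^ k" by (intro power_increasing) auto
      then have "(\<delta> * (real k - 1)) * ?s ^ (k - 1) \<le> (\<delta> * (real k - 1)) * ?s ^ k"
        using nn \<open>1 \<le> k\<close> by (intro mult_left_mono) auto
      then show ?thesis by simp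
    qed
    also have "c ^ Suc k + \<delta> * (real k - 1) * ?s ^ k + \<delta> * ?s ^ k =
        c ^ Suc k + \<delta> * (real (Suc k) - 1) * ?s ^ (Suc k - 1)"
      by (simp add: algebra_simps)
    finally show ?case by simp
  qed
qed

end

section \<open>Classical strategies\<close>

interpretation classical: correlation "(*) :: real \<Rightarrow> real \<Rightarrow> real" "{0..}" 1
  by standard (auto simp: bilinear_times)

lemma classical_strategy_iff:
  "classical_strategy R f g \<longleftrightarrow>
    classical.POVM (quest1 R) (ans1 R) f \<and> classical.POVM (quest2 R) (ans2 R) g"
  unfolding classical_strategy_def classical_substrategy_def classical_sub_def classical.POVM_def
  by auto

lemma classical_substrategy_iff:
  "classical_substrategy R f g \<longleftrightarrow>
    classical.subPOVM (quest1 R) (ans1 R) f \<and> classical.subPOVM (quest2 R) (ans2 R) g"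
  unfolding classical_substrategy_def classical_sub_def classical.subPOVM_def by auto

lemma classical_value_eq: "classical_value = classical.game_value"
  unfolding classical_value_def classical.game_value_def by (intro ext) simp

text \<open>The expectation over \<open>pmf_of_set\<close> is the uniform average once the
  neighbourhood is finite and nonempty, which \<open>x \<in> X\<close> guarantees.\<close>

lemma induced_classical_eq:
  assumes "is_bipartite_graph E X' X" "x \<in> X"
  shows "induced_classical E S f x a = induced E S f x a"
  using is_bipartite_graphD[OF assms(1)] assms(2)
  by (simp add: induced_classical_def induced_def integral_pmf_of_set)

lemma classical_value_le_Val:
  assumes "finite_game R" "classical_strategy R f g"
  shows "classical_value R f g \<le> Val R"
  unfolding Val_def using assms
  by (intro cSup_upper bdd_aboveI[of _ 1])
    (auto simp: classical_strategy_iff classical_value_eq intro: classical.game_value_le_1)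

lemma Val_nonneg:
  assumes "finite_game R" shows "0 \<le> Val R"
  unfolding Val_def using assms
  by (intro cSup_upper bdd_aboveI[of _ 1])
    (auto simp: classical_strategy_iff classical_value_eq intro: classical.game_value_le_1)

lemma Val_repeated_concat_le:
  assumes "0 \<le> \<epsilon>" "0 \<le> \<delta>" "1 \<le> m"
    and G: "is_game G" and M: "is_bipartite_graph M X' (questX G)"
    and P: "is_bipartite_graph P Y' (questY G)"
    and fort: "weakly_fortified_classical \<epsilon> \<delta> X' M G Y' P"
  shows "Val (repeated_game m (concat_game X' M G Y' P)) \<le>
    (Val (plain G) + \<epsilon>) ^ m + \<delta> * (real m - 1) * real (card (ansA G) * card (ansB G)) ^ (m - 1)"
  unfolding Val_def[of "repeated_game m _"]
proof (rule cSup_least)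
  note V0 = Val_nonneg[OF finite_plain_game[OF G]]
  fix z assume "z \<in> insert 0 {classical_value (repeated_game m (concat_game X' M G Y' P)) f g |f g.
    classical_strategy (repeated_game m (concat_game X' M G Y' P)) f g}"
  then consider "z = 0" | f g where "z = classical_value (repeated_game m (concat_game X' M G Y' P)) f g"
    "classical_strategy (repeated_game m (concat_game X' M G Y' P)) f g" by blast
  then show "z \<le> (Val (plain G) + \<epsilon>) ^ m +
      \<delta> * (real m - 1) * real (card (ansA G) * card (ansB G)) ^ (m - 1)"
  proof cases
    case 1
    then show ?thesis using V0 assms(1-3) by simp
  next
    case 2
    show ?thesis
      unfolding 2(1) classical_value_eq
    proof (rule classical.game_value_repeated_concat_le[OF G M P assms(3) V0 _ assms(2)])
      show "classical.game_value (plain G) F H \<le> Val (plain G)"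
        if "classical.POVM (questX G) (\<lambda>_. ansA G) F" "classical.POVM (questY G) (\<lambda>_. ansB G) H" for F H
        using classical_value_le_Val[OF finite_plain_game[OF G], of F H] that
        by (simp add: classical_value_eq classical_strategy_iff)
      show "classical.game_value (concat_game X' M G Y' P) F H \<le> (Val (plain G) + \<epsilon>) *
          measure_pmf.expectation (qdist G) (\<lambda>(x, y). (\<Sum>a\<in>ansA G. induced M (ansA G) F x a) *
            (\<Sum>b\<in>ansB G. induced P (ansB G) H y b)) + \<delta>"
        if "classical.subPOVM X' (\<lambda>x'. (M `` {x'}) \<rightarrow>\<^sub>E ansA G) F"
          "classical.subPOVM Y' (\<lambda>y'. (P `` {y'}) \<rightarrow>\<^sub>E ansB G) H" for F H
      proof -
        have "measure_pmf.expectation (qdist G) (\<lambda>(x, y). (\<Sum>a\<in>ansA G. induced_classical M (ansA G) F x a) *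
            (\<Sum>b\<in>ansB G. induced_classical P (ansB G) H y b)) =
          measure_pmf.expectation (qdist G) (\<lambda>(x, y). (\<Sum>a\<in>ansA G. induced M (ansA G) F x a) *
            (\<Sum>b\<in>ansB G. induced P (ansB G) H y b))"
          by (rule expectation_cong) (auto simp: is_gameD[OF G] induced_classical_eq[OF M] induced_classical_eq[OF P])
        moreover have "classical_substrategy (concat_game X' M G Y' P) F H"
          using that by (simp add: classical_substrategy_iff)
        ultimately show ?thesis
          using fort unfolding weakly_fortified_classical_def classical_value_eq by metis
      qed
    qed (use 2(2) assms(1) in \<open>auto simp: classical_strategy_iff\<close>)
  qed
qed simp

section \<open>Positive semidefinite kernels\<close>

text \<open>Pointwise scaling makes kernels
  \<open>nat \<Rightarrow> nat \<Rightarrow> complex\<close> a real vector space, as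
  \<open>correlation\<close> demands of its operators.\<close>

instantiation "fun" :: (type, real_vector) real_vector
begin

definition scaleR_fun :: "real \<Rightarrow> ('a \<Rightarrow> 'b) \<Rightarrow> 'a \<Rightarrow> 'b" where
  "scaleR_fun c f = (\<lambda>x. c *\<^sub>R f x)"

instance
  by standard (auto simp: scaleR_fun_def fun_eq_iff algebra_simps)

end

lemma scaleR_fun_apply [simp]: "(c *\<^sub>R f) x = c *\<^sub>R f x"
  by (simp add: scaleR_fun_def)

lemma sum_fun_apply: "(\<Sum>i\<in>I. f i) x = (\<Sum>i\<in>I. f i x)"
  by (induction I rule: infinite_finite_induct) auto

text \<open>The index set is arbitrary so that points can be split off in an induction. Since
  \<open>0 \<le>\<close> on complex numbers includes being real, Hermitian symmetry is a
  consequence.\<close>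

definition psd_on :: "'i set \<Rightarrow> ('i \<Rightarrow> 'i \<Rightarrow> complex) \<Rightarrow> bool" where
  "psd_on I A \<longleftrightarrow> (\<forall>v. 0 \<le> (\<Sum>i\<in>I. \<Sum>j\<in>I. A i j * v j * cnj (v i)))"

lemma psd_onD: "psd_on I A \<Longrightarrow> 0 \<le> (\<Sum>i\<in>I. \<Sum>j\<in>I. A i j * v j * cnj (v i))"
  by (simp add: psd_on_def)

lemma quadratic_form_insert:
  fixes A :: "'i \<Rightarrow> 'i \<Rightarrow> complex"
  assumes "finite I" "p \<notin> I"
  shows "(\<Sum>i\<in>insert p I. \<Sum>j\<in>insert p I. A i j * v j * cnj (v i)) =
    A p p * v p * cnj (v p) + (\<Sum>j\<in>I. A p j * v j) * cnj (v p) + v p * (\<Sum>i\<in>I. A i p * cnj (v i)) +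
    (\<Sum>i\<in>I. \<Sum>j\<in>I. A i j * v j * cnj (v i))"
  using assms by (simp add: sum.distrib sum_distrib_left sum_distrib_right algebra_simps)

text \<open>The form is evaluated at the vector with entries \<open>x\<close> at \<open>p\<close>,
  \<open>y\<close> at \<open>i\<close> and zero elsewhere.\<close>

lemma psd_on_two_points:
  assumes "psd_on (insert p I) A" "finite I" "p \<notin> I" "i \<in> I"
  shows "0 \<le> A p p * x * cnj x + A p i * y * cnj x + A i p * x * cnj y + A i i * y * cnj y"
proof -
  define v where "v j = (if j = p then x else if j = i then y else 0)" for j
  have "i \<noteq> p" using assms by auto
  have [simp]: "v p = x" "v i = y" using \<open>i \<noteq> p\<close> by (auto simp: v_def)
  have z: "v j = 0" if "j \<in> I" "j \<noteq> i" for j using that assms by (auto simp: v_def)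
  have *: "(\<Sum>j\<in>I. f j) = f i" if "\<And>j. j \<in> I \<Longrightarrow> j \<noteq> i \<Longrightarrow> f j = 0" for f :: "_ \<Rightarrow> complex"
    using assms that by (subst sum.remove[of _ i]) (auto intro!: sum.neutral)
  have "0 \<le> A p p * v p * cnj (v p) + (\<Sum>j\<in>I. A p j * v j) * cnj (v p) +
      v p * (\<Sum>i\<in>I. A i p * cnj (v i)) + (\<Sum>i\<in>I. \<Sum>j\<in>I. A i j * v j * cnj (v i))"
    using assms(1) unfolding psd_on_def quadratic_form_insert[OF assms(2,3)] by blast
  moreover have "(\<Sum>j\<in>I. A p j * v j) = A p i * y" by (subst *) (auto simp: z)
  moreover have "(\<Sum>j\<in>I. A j p * cnj (v j)) = A i p * cnj y" by (subst *) (auto simp: z)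
  moreover have "(\<Sum>i\<in>I. \<Sum>j\<in>I. A i j * v j * cnj (v i)) = A i i * y * cnj y"
    by (subst *) (auto simp: z *)
  ultimately show ?thesis by (simp add: algebra_simps)
qed

lemma psd_on_diag:
  assumes "psd_on (insert p I) A" "finite I" "p \<notin> I"
  shows "0 \<le> A p p"
proof -
  let ?v = "\<lambda>i. if i = p then 1 else 0 :: complex"
  have "?v i = 0" if "i \<in> I" for i using that assms(3) by auto
  then show ?thesis
    using psd_onD[OF assms(1), of ?v] unfolding quadratic_form_insert[OF assms(2,3)] by simp
qed

text \<open>Polarisation: the form is real at (1, 1) and at (1, \<i>), which gives the imaginary and
  the real part of the identity.\<close>

lemma psd_on_hermitian:
  assumes "psd_on (insert p I) A" "finite I" "p \<notin> I" "i \<in> I"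
  shows "A i p = cnj (A p i)"
proof -
  note two = psd_on_two_points[OF assms]
  have d: "Im (A p p) = 0" "Im (A i i) = 0"
    using two[of 1 0] two[of 0 1] by (auto simp: less_eq_complex_def)
  show ?thesis using two[of 1 1] two[of 1 \<i>] d
    by (simp add: less_eq_complex_def complex_eq_iff)
qed

text \<open>At \<open>x = - s * cnj (A i p)\<close>, \<open>y = 1\<close> the form equals
  \<open>A i i\<close> minus 2 s |A i p|^2, which is unbounded below in \<open>s\<close> unless
  \<open>A i p = 0\<close>.\<close>

lemma psd_on_zero_diag:
  assumes "psd_on (insert p I) A" "finite I" "p \<notin> I" "i \<in> I" "A p p = 0"
  shows "A i p = 0" "A p i = 0"
proof -
  note two = psd_on_two_points[OF assms(1-4)] and h = psd_on_hermitian[OF assms(1-4)]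
  define n where "n = (Re (A i p))\<^sup>2 + (Im (A i p))\<^sup>2"
  have le: "0 \<le> Re (A i i) - 2 * s * n" for s :: real
    using two[of "- of_real s * cnj (A i p)" 1] h assms(5)
    by (simp add: n_def less_eq_complex_def power2_eq_square algebra_simps)
  have "n = 0"
  proof (rule ccontr)
    assume "n \<noteq> 0"
    then have "2 * ((Re (A i i) + 1) / (2 * n)) * n = Re (A i i) + 1" by simp
    then show False using le[of "(Re (A i i) + 1) / (2 * n)"] by linarith
  qed
  then show "A i p = 0" by (simp add: n_def complex_eq_iff sum_power2_eq_zero_iff)
  then show "A p i = 0" using h by simp
qed

text \<open>If \<open>A p p = 0\<close>, then \<open>x / 0 = 0\<close> makes the correction vanish, as it should.\<close>

lemma psd_on_Schur_complement:
  assumes A: "psd_on (insert p I) A" and I: "finite I" "p \<notin> I"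
  shows "psd_on I (\<lambda>i j. A i j - A i p * A p j / A p p)"
  unfolding psd_on_def
proof
  fix v
  define s where "s = (\<Sum>j\<in>I. A p j * v j)"
  \<comment> \<open>Completing the square: this entry at \<open>p\<close> minimises the extended
    form, and the minimum is the form of the Schur complement at \<open>v\<close>.\<close>
  define w where "w = v(p := - s / A p p)"
  have w: "w j = v j" if "j \<in> I" for j using that I by (auto simp: w_def)
  have conj_s: "(\<Sum>i\<in>I. A i p * cnj (v i)) = cnj s"
    unfolding s_def cnj_sum by (intro sum.cong) (auto simp: psd_on_hermitian[OF A I])
  have d: "cnj (A p p) = A p p"
    using psd_on_diag[OF assms] by (simp add: less_eq_complex_def complex_eq_iff)
  have "(\<Sum>i\<in>I. \<Sum>j\<in>I. (A i j - A i p * A p j / A p p) * v j * cnj (v i)) =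
      (\<Sum>i\<in>I. \<Sum>j\<in>I. A i j * v j * cnj (v i)) - s * cnj s / A p p"
    unfolding conj_s[symmetric] unfolding s_def
    by (simp add: algebra_simps sum_subtractf sum_distrib_left sum_distrib_right sum_divide_distrib)
  also have "\<dots> = A p p * w p * cnj (w p) + s * cnj (w p) + w p * cnj s +
      (\<Sum>i\<in>I. \<Sum>j\<in>I. A i j * v j * cnj (v i))"
    by (cases "A p p = 0") (simp_all add: w_def d field_simps)
  also have "\<dots> = (\<Sum>i\<in>insert p I. \<Sum>j\<in>insert p I. A i j * w j * cnj (w i))"
    unfolding quadratic_form_insert[OF I] by (simp add: w s_def conj_s[unfolded s_def])
  also have "0 \<le> \<dots>" using A unfolding psd_on_def by blast
  finally show "0 \<le> (\<Sum>i\<in>I. \<Sum>j\<in>I. (A i j - A i p * A p j / A p p) * v j * cnj (v i))" .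
qed

lemma psd_on_subset:
  assumes "psd_on (insert p I) A" "finite I" "p \<notin> I"
  shows "psd_on I A"
  unfolding psd_on_def
proof
  fix v :: "_ \<Rightarrow> complex"
  have "(v(p := 0)) i = v i" if "i \<in> I" for i using that assms(3) by auto
  then show "0 \<le> (\<Sum>i\<in>I. \<Sum>j\<in>I. A i j * v j * cnj (v i))"
    using psd_onD[OF assms(1), of "v(p := 0)"] unfolding quadratic_form_insert[OF assms(2,3)]
    by (simp del: fun_upd_apply add: fun_upd_same)
qed

text \<open>The Schur product theorem at the all-ones vector. Subtracting the rank-one kernel
  \<open>r\<close> clears row and column \<open>p\<close> and leaves a Schur complement for the
  induction hypothesis.\<close>

lemma psd_on_Schur_product:
  assumes "finite I" "psd_on I A" "psd_on I B"
  shows "0 \<le> (\<Sum>i\<in>I. \<Sum>j\<in>I. A i j * B i j)"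
  using assms
proof (induction I arbitrary: A)
  case empty
  then show ?case by simp
next
  case (insert p I)
  note A = insert.prems(1) and I = insert.hyps(1,2)
  define r where "r i j = A i p * A p j / A p p" for i j
  have "0 \<le> (\<Sum>i\<in>I. \<Sum>j\<in>I. (A i j - r i j) * B i j)"
    unfolding r_def
    by (intro insert.IH psd_on_Schur_complement[OF A I] psd_on_subset[OF insert.prems(2) I])
  also have "\<dots> = (\<Sum>i\<in>insert p I. \<Sum>j\<in>insert p I. (A i j - r i j) * B i j)"
  proof -
    \<comment> \<open>If \<open>A p p = 0\<close>, then \<open>r\<close> is zero, but row and column
      \<open>p\<close> of \<open>A\<close> vanish already.\<close>
    have "A i p - r i p = 0" "A p i - r p i = 0" if "i \<in> insert p I" for i
      using that psd_on_zero_diag[OF A I] by (cases "A p p = 0"; auto simp: r_def)+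
    then show ?thesis using I by (simp add: sum.distrib)
  qed
  finally have 1: "0 \<le> (\<Sum>i\<in>insert p I. \<Sum>j\<in>insert p I. (A i j - r i j) * B i j)" .
  have h: "A i p = cnj (A p i)" if "i \<in> insert p I" for i
    using that psd_on_hermitian[OF A I] psd_on_diag[OF A I]
    by (auto simp: less_eq_complex_def complex_eq_iff)
  \<comment> \<open>By Hermitian symmetry the rank-one part paired with \<open>B\<close> is the form
    of \<open>B\<close> at the vector \<open>A p\<close>, divided by \<open>A p p\<close>.\<close>
  have "(\<Sum>i\<in>insert p I. \<Sum>j\<in>insert p I. r i j * B i j) =
      (\<Sum>i\<in>insert p I. \<Sum>j\<in>insert p I. B i j * A p j * cnj (A p i)) / A p p"
    unfolding r_def sum_divide_distrib
    by (intro sum.cong refl) (simp only: h mult_ac times_divide_eq_right times_divide_eq_left)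
  also have "0 \<le> \<dots>"
  proof -
    have "0 \<le> (\<Sum>i\<in>insert p I. \<Sum>j\<in>insert p I. B i j * A p j * cnj (A p i))"
      using insert.prems(2) unfolding psd_on_def by blast
    then show ?thesis using psd_on_diag[OF A I] by (auto simp: less_eq_complex_def complex_is_Real_iff Re_divide Im_divide)
  qed
  finally have "0 \<le> (\<Sum>i\<in>insert p I. \<Sum>j\<in>insert p I. r i j * B i j)" .
  from add_nonneg_nonneg[OF 1 this] show ?case
    by (simp only: sum.distrib[symmetric] ring_distribs[symmetric] diff_add_cancel)
qed

section \<open>Entangled strategies\<close>

text \<open>
  The type \<^typ>\<open>complex mat\<close> contains matrices of all sizes and is not a vector space, so operators are
  handled as kernels on \<^typ>\<open>nat\<close>, of which only the entries below \<open>d\<close> matter.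
\<close>

definition fun_of_mat :: "nat \<Rightarrow> complex mat \<Rightarrow> nat \<Rightarrow> nat \<Rightarrow> complex" where
  "fun_of_mat d A = (\<lambda>i j. if i < d \<and> j < d then A $$ (i, j) else 0)"

definition mat_of_fun :: "nat \<Rightarrow> (nat \<Rightarrow> nat \<Rightarrow> complex) \<Rightarrow> complex mat" where
  "mat_of_fun d F = mat d d (\<lambda>(i, j). F i j)"

text \<open>Cut off at \<open>d\<close> like \<open>fun_of_mat\<close>: \<open>POVM\<close> demands
  equality of kernels on all of \<open>nat\<close>, not only inside the block.\<close>

definition id_fun :: "nat \<Rightarrow> nat \<Rightarrow> nat \<Rightarrow> complex" where
  "id_fun d = (\<lambda>i j. if i = j \<and> i < d then 1 else 0)"

lemma mat_of_fun_of_mat: "A \<in> carrier_mat d d \<Longrightarrow> mat_of_fun d (fun_of_mat d A) = A"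
  by (rule eq_matI) (auto simp: mat_of_fun_def fun_of_mat_def)

lemma mat_of_fun_carrier [simp]: "mat_of_fun d F \<in> carrier_mat d d"
  by (simp add: mat_of_fun_def)

lemma mat_of_fun_id: "mat_of_fun d (id_fun d) = 1\<^sub>m d"
  by (rule eq_matI) (auto simp: mat_of_fun_def id_fun_def)

lemma mat_of_fun_diff: "mat_of_fun d (F - H) = mat_of_fun d F - mat_of_fun d H"
  by (rule eq_matI) (auto simp: mat_of_fun_def)

lemma mat_sum_of_fun: "mat_sum d (\<lambda>a. mat_of_fun d (F a)) S = mat_of_fun d (\<Sum>a\<in>S. F a)"
  by (rule eq_matI) (auto simp: mat_of_fun_def mat_sum_def sum_fun_apply)

lemma pos_semidef_mat_of_fun: "pos_semidef d (mat_of_fun d F) \<longleftrightarrow> psd_on {..<d} F"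
proof -
  have form: "(mat_of_fun d F *\<^sub>v v) \<bullet>c v = (\<Sum>i<d. \<Sum>j<d. F i j * v $ j * cnj (v $ i))"
    if "v \<in> carrier_vec d" for v
    using that by (simp add: mat_of_fun_def scalar_prod_def sum_distrib_right atLeast0LessThan)
  show ?thesis
  proof
    assume L: "pos_semidef d (mat_of_fun d F)"
    show "psd_on {..<d} F" unfolding psd_on_def
    proof
      fix v :: "nat \<Rightarrow> complex"
      have "0 \<le> (mat_of_fun d F *\<^sub>v vec d v) \<bullet>c vec d v"
        using L unfolding pos_semidef_def by simp
      then show "0 \<le> (\<Sum>i<d. \<Sum>j<d. F i j * v j * cnj (v i))" by (simp add: form)
    qed
  next
    assume "psd_on {..<d} F"
    then show "pos_semidef d (mat_of_fun d F)"
      by (auto simp: pos_semidef_def form intro: psd_onD)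
  qed
qed

section \<open>The form <\<psi>| A \<otimes> B |\<psi>> on kernels\<close>

lemma sum_swap_pairs:
  "(\<Sum>i\<in>A. \<Sum>j\<in>B. \<Sum>k\<in>C. \<Sum>l\<in>D. f i j k l) = (\<Sum>k\<in>C. \<Sum>l\<in>D. \<Sum>i\<in>A. \<Sum>j\<in>B. f i j k l)"
proof -
  have "(\<Sum>i\<in>A. \<Sum>j\<in>B. \<Sum>k\<in>C. \<Sum>l\<in>D. f i j k l) = (\<Sum>i\<in>A. \<Sum>k\<in>C. \<Sum>j\<in>B. \<Sum>l\<in>D. f i j k l)"
    by (rule sum.cong[OF refl], rule sum.swap)
  also have "\<dots> = (\<Sum>k\<in>C. \<Sum>i\<in>A. \<Sum>j\<in>B. \<Sum>l\<in>D. f i j k l)"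
    by (rule sum.swap)
  also have "\<dots> = (\<Sum>k\<in>C. \<Sum>i\<in>A. \<Sum>l\<in>D. \<Sum>j\<in>B. f i j k l)"
    by (rule sum.cong[OF refl], rule sum.cong[OF refl], rule sum.swap)
  also have "\<dots> = (\<Sum>k\<in>C. \<Sum>l\<in>D. \<Sum>i\<in>A. \<Sum>j\<in>B. f i j k l)"
    by (rule sum.cong[OF refl], rule sum.swap)
  finally show ?thesis .
qed

text \<open>An index of the tensor product is a pair (div d, mod d). Contracting \<open>H\<close>
  with \<psi> first exhibits bilinearity and gives the entrywise pairing to which the Schur product
  theorem applies.\<close>

lemma tensor_expect_mat_of_fun:
  assumes "\<psi> \<in> carrier_vec (d * d)"
  shows "tensor_expect \<psi> (mat_of_fun d F) (mat_of_fun d H) =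
    Re (\<Sum>i<d. \<Sum>j<d. F i j * (\<Sum>k<d. \<Sum>l<d. H k l * \<psi> $ (l + j * d) * cnj (\<psi> $ (k + i * d))))"
proof -
  have md: "I mod d < d" if "I < d * d" for I using that by (cases d) auto
  have "(tensor_mat (mat_of_fun d F) (mat_of_fun d H) *\<^sub>v \<psi>) \<bullet>c \<psi> =
    (\<Sum>I<d * d. \<Sum>J<d * d. F (I div d) (J div d) * H (I mod d) (J mod d) * \<psi> $ J * cnj (\<psi> $ I))"
    using assms
    by (simp add: tensor_mat_def mat_of_fun_def scalar_prod_def sum_distrib_right atLeast0LessThan
        less_mult_imp_div_less)
      (intro sum.cong refl, auto simp: less_mult_imp_div_less md)
  also have "\<dots> = (\<Sum>i<d. \<Sum>k<d. \<Sum>j<d. \<Sum>l<d. F i j * H k l * \<psi> $ (l + j * d) * cnj (\<psi> $ (k + i * d)))"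
    unfolding sum_mult_product by (intro sum.cong refl) auto
  also have "\<dots> = (\<Sum>i<d. \<Sum>j<d. F i j * (\<Sum>k<d. \<Sum>l<d. H k l * \<psi> $ (l + j * d) * cnj (\<psi> $ (k + i * d))))"
    unfolding sum_distrib_left mult.assoc by (intro sum.cong refl sum.swap)
  finally show ?thesis by (simp add: tensor_expect_def)
qed

locale entangled_state =
  fixes d :: nat and \<psi> :: "complex vec"
  assumes \<psi>: "\<psi> \<in> carrier_vec (d * d)" "\<psi> \<bullet>c \<psi> = 1"
begin

text \<open>The form of the contraction \<open>?B\<close> at \<open>w\<close> is the form of
  \<open>H\<close> at \<open>?v\<close>, the image of \<open>w\<close> under \<psi> reshaped to a d
  by d matrix. So \<open>?B\<close> is positive semidefinite, and its entrywise pairing with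
  \<open>F\<close> is nonnegative.\<close>

lemma tensor_expect_nonneg:
  assumes F: "psd_on {..<d} F" and H: "psd_on {..<d} H"
  shows "0 \<le> tensor_expect \<psi> (mat_of_fun d F) (mat_of_fun d H)"
proof -
  let ?B = "\<lambda>i j. \<Sum>k<d. \<Sum>l<d. H k l * \<psi> $ (l + j * d) * cnj (\<psi> $ (k + i * d))"
  have "psd_on {..<d} ?B"
    unfolding psd_on_def
  proof
    fix w :: "nat \<Rightarrow> complex"
    let ?v = "\<lambda>l. \<Sum>j<d. \<psi> $ (l + j * d) * w j"
    have "(\<Sum>i<d. \<Sum>j<d. ?B i j * w j * cnj (w i)) =
      (\<Sum>i<d. \<Sum>j<d. \<Sum>k<d. \<Sum>l<d. H k l * (\<psi> $ (l + j * d) * w j) * cnj (\<psi> $ (k + i * d) * w i))"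
      by (simp add: sum_distrib_left sum_distrib_right mult_ac)
    also have "\<dots> = (\<Sum>k<d. \<Sum>l<d. \<Sum>i<d. \<Sum>j<d. H k l * (\<psi> $ (l + j * d) * w j) * cnj (\<psi> $ (k + i * d) * w i))"
      by (rule sum_swap_pairs)
    also have "\<dots> = (\<Sum>k<d. \<Sum>l<d. H k l * ?v l * cnj (?v k))"
      unfolding cnj_sum by (simp add: sum_distrib_left sum_distrib_right)
    also have "0 \<le> \<dots>" by (rule psd_onD[OF H])
    finally show "0 \<le> (\<Sum>i<d. \<Sum>j<d. ?B i j * w j * cnj (w i))" .
  qed
  from psd_on_Schur_product[OF _ F this] show ?thesis
    by (simp add: tensor_expect_mat_of_fun[OF \<psi>(1)] less_eq_complex_def)
qed

lemma tensor_expect_id: "tensor_expect \<psi> (mat_of_fun d (id_fun d)) (mat_of_fun d (id_fun d)) = 1"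
proof -
  have "(\<Sum>j<d. id_fun d i j * f j) = f i" if "i < d" for i and f :: "nat \<Rightarrow> complex"
    using that by (simp add: id_fun_def if_distrib[of "\<lambda>z. z * _"] cong: if_cong)
  then have "(\<Sum>i<d. \<Sum>j<d. id_fun d i j * (\<Sum>k<d. \<Sum>l<d. id_fun d k l * \<psi> $ (l + j * d) * cnj (\<psi> $ (k + i * d)))) =
      (\<Sum>i<d. \<Sum>k<d. \<psi> $ (k + i * d) * cnj (\<psi> $ (k + i * d)))"
    by (simp add: mult.assoc)
  also have "\<dots> = \<psi> \<bullet>c \<psi>"
    using \<psi>(1) by (simp add: scalar_prod_def atLeast0LessThan sum_mult_product)
  finally show ?thesis using \<psi> by (simp add: tensor_expect_mat_of_fun)
qed

sublocale correlation "\<lambda>F H. tensor_expect \<psi> (mat_of_fun d F) (mat_of_fun d H)"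
  "{F. psd_on {..<d} F}" "id_fun d"
proof
  show "bilinear (\<lambda>F H. tensor_expect \<psi> (mat_of_fun d F) (mat_of_fun d H))"
    unfolding bilinear_def tensor_expect_mat_of_fun[OF \<psi>(1)]
    by (intro conjI allI linearI)
      (simp_all add: sum.distrib algebra_simps sum_distrib_left scaleR_conv_of_real)
  show "F + H \<in> {F. psd_on {..<d} F}" if "F \<in> {F. psd_on {..<d} F}" "H \<in> {F. psd_on {..<d} F}" for F H
    using that by (simp add: psd_on_def distrib_right sum.distrib add_nonneg_nonneg)
  show "c *\<^sub>R F \<in> {F. psd_on {..<d} F}" if "0 \<le> c" "F \<in> {F. psd_on {..<d} F}" for c F
    using that by (simp add: psd_on_def scaleR_sum_right[symmetric] scaleR_nonneg_nonneg)
  show "id_fun d \<in> {F. psd_on {..<d} F}"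
  proof -
    have "(\<Sum>i<d. \<Sum>j<d. id_fun d i j * v j * cnj (v i)) = (\<Sum>i<d. v i * cnj (v i))" for v
      by (simp add: id_fun_def if_distrib[of "\<lambda>z. z * _"] cong: if_cong)
    moreover have "0 \<le> z * cnj z" for z by (simp add: less_eq_complex_def)
    ultimately show ?thesis by (simp add: psd_on_def sum_nonneg)
  qed
qed (auto simp: tensor_expect_nonneg tensor_expect_id)

section \<open>Translation between kernels and entangled strategies\<close>

lemma entangled_value_mat_of_fun:
  "entangled_value R \<psi> (\<lambda>q a. mat_of_fun d (F q a)) (\<lambda>q b. mat_of_fun d (H q b)) = game_value R F H"
  by (simp add: entangled_value_def game_value_def)

text \<open>An equivalence, because \<open>psd_on {..<d}\<close> ignores entries outside the block
  just as \<open>mat_of_fun\<close> does.\<close>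

lemma quantum_sub_mat_of_fun: "quantum_sub Q S d (\<lambda>q a. mat_of_fun d (F q a)) \<longleftrightarrow> subPOVM Q S F"
  by (simp add: quantum_sub_def subPOVM_def loewner_le_def mat_sum_of_fun pos_semidef_mat_of_fun
      mat_of_fun_id[symmetric] mat_of_fun_diff[symmetric])

lemma subPOVM_if_POVM: "POVM Q S F \<Longrightarrow> subPOVM Q S F"
  by (simp add: POVM_def subPOVM_def zero_K[simplified])

lemma entangled_substrategy_mat_of_fun:
  assumes "subPOVM (quest1 R) (ans1 R) F" "subPOVM (quest2 R) (ans2 R) H"
  shows "entangled_substrategy R d \<psi> (\<lambda>q a. mat_of_fun d (F q a)) (\<lambda>q b. mat_of_fun d (H q b))"
  using assms \<psi> by (simp add: entangled_substrategy_def quantum_sub_mat_of_fun)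

lemma entangled_strategy_mat_of_fun:
  assumes "POVM (quest1 R) (ans1 R) F" "POVM (quest2 R) (ans2 R) H"
  shows "entangled_strategy R d \<psi> (\<lambda>q a. mat_of_fun d (F q a)) (\<lambda>q b. mat_of_fun d (H q b))"
  using entangled_substrategy_mat_of_fun[OF assms[THEN subPOVM_if_POVM]] POVM_D(2)[OF assms(1)] POVM_D(2)[OF assms(2)]
  by (simp add: entangled_strategy_def mat_sum_of_fun mat_of_fun_id)

lemma quantum_sub_carrier: "quantum_sub Q S d A \<Longrightarrow> q \<in> Q \<Longrightarrow> a \<in> S q \<Longrightarrow> A q a \<in> carrier_mat d d"
  by (simp add: quantum_sub_def pos_semidef_def)

lemma POVM_fun_of_mat:
  assumes A: "quantum_sub Q S d A" and one: "\<forall>q\<in>Q. mat_sum d (A q) (S q) = 1\<^sub>m d"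
  shows "POVM Q S (\<lambda>q a. fun_of_mat d (A q a))"
  unfolding POVM_def
proof (intro ballI conjI)
  fix q assume q: "q \<in> Q"
  show "fun_of_mat d (A q a) \<in> {F. psd_on {..<d} F}" if "a \<in> S q" for a
    using A q that quantum_sub_carrier[OF A q that]
    by (simp add: pos_semidef_mat_of_fun[symmetric] mat_of_fun_of_mat quantum_sub_def)
  have "(\<Sum>a\<in>S q. A q a $$ (i, j)) = 1\<^sub>m d $$ (i, j)" if "i < d" "j < d" for i j
    using one[rule_format, OF q, THEN arg_cong, of "\<lambda>B. B $$ (i, j)"] that by (simp add: mat_sum_def)
  then have "(\<Sum>a\<in>S q. fun_of_mat d (A q a)) i j = id_fun d i j" for i j
    by (cases "i < d \<and> j < d") (auto simp: sum_fun_apply fun_of_mat_def id_fun_def)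
  then show "(\<Sum>a\<in>S q. fun_of_mat d (A q a)) = id_fun d" by (intro ext)
qed

lemma entangled_value_fun_of_mat:
  assumes R: "finite_game R" and AB: "entangled_substrategy R d \<psi> A B"
  shows "entangled_value R \<psi> A B =
    game_value R (\<lambda>q a. fun_of_mat d (A q a)) (\<lambda>q b. fun_of_mat d (B q b))"
  unfolding entangled_value_def game_value_def
proof (intro expectation_cong finite_gameD(1)[OF R] sum.cong refl, clarify)
  fix r a b assume r: "r \<in> set_pmf (referee R)" and "(a, b) \<in> accepted R r"
  then have "a \<in> ans1 R (ask1 R r)" "b \<in> ans2 R (ask2 R r)" by (auto simp: accepted_def)
  moreover have "quantum_sub (quest1 R) (ans1 R) d A" "quantum_sub (quest2 R) (ans2 R) d B"
    using AB by (auto simp: entangled_substrategy_def)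
  ultimately show "tensor_expect \<psi> (A (ask1 R r) a) (B (ask2 R r) b) =
      tensor_expect \<psi> (mat_of_fun d (fun_of_mat d (A (ask1 R r) a))) (mat_of_fun d (fun_of_mat d (B (ask2 R r) b)))"
    using finite_gameD(2,3)[OF R r] quantum_sub_carrier by (metis mat_of_fun_of_mat)
qed

lemma POVM_of_entangled_strategy:
  assumes "entangled_strategy R d \<psi> A B"
  shows "POVM (quest1 R) (ans1 R) (\<lambda>q a. fun_of_mat d (A q a))"
    and "POVM (quest2 R) (ans2 R) (\<lambda>q b. fun_of_mat d (B q b))"
  using assms by (auto simp: entangled_strategy_def entangled_substrategy_def intro!: POVM_fun_of_mat)

lemma entangled_value_le_1:
  assumes R: "finite_game R" and AB: "entangled_strategy R d \<psi> A B"
  shows "entangled_value R \<psi> A B \<le> 1"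
  using game_value_le_1[OF R POVM_of_entangled_strategy[OF AB]] AB
  by (simp add: entangled_value_fun_of_mat[OF R] entangled_strategy_def)

end

text \<open>Allows the fortification hypothesis, stated for matrices, to be read as one about
  kernels.\<close>

lemma mat_sum_induced_quantum:
  "mat_sum d (induced_quantum E S d (\<lambda>q a. mat_of_fun d (F q a)) x) S =
    mat_of_fun d (\<Sum>a\<in>S. induced E S F x a)"
  unfolding induced_quantum_def induced_def mat_sum_of_fun
  by (rule eq_matI) (auto simp: mat_sum_def mat_of_fun_def sum_fun_apply scaleR_conv_of_real)

lemma entangled_strategy_imp_state: "entangled_strategy R d \<psi> A B \<Longrightarrow> entangled_state d \<psi>"
  by (simp add: entangled_strategy_def entangled_substrategy_def entangled_state_def)

lemma bdd_above_entangled_values: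
  assumes "finite_game R"
  shows "bdd_above (insert 0 {entangled_value R \<psi> A B |d \<psi> A B. entangled_strategy R d \<psi> A B})"
  using assms
  by (auto intro!: bdd_aboveI[of _ 1] entangled_state.entangled_value_le_1 entangled_strategy_imp_state)

lemma Val_star_nonneg: "finite_game R \<Longrightarrow> 0 \<le> Val_star R"
  unfolding Val_star_def by (intro cSup_upper bdd_above_entangled_values) auto

lemma entangled_value_le_Val_star:
  assumes "finite_game R" "entangled_strategy R d \<psi> A B"
  shows "entangled_value R \<psi> A B \<le> Val_star R"
  unfolding Val_star_def using assms(2) by (intro cSup_upper bdd_above_entangled_values assms(1)) auto

lemma Val_star_repeated_concat_le:
  assumes "0 \<le> \<epsilon>" "0 \<le> \<delta>" "1 \<le> m"
    and G: "is_game G" and M: "is_bipartite_graph M X' (questX G)"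
    and P: "is_bipartite_graph P Y' (questY G)"
    and fort: "weakly_fortified_entangled \<epsilon> \<delta> X' M G Y' P"
  shows "Val_star (repeated_game m (concat_game X' M G Y' P)) \<le>
    (Val_star (plain G) + \<epsilon>) ^ m + \<delta> * (real m - 1) * real (card (ansA G) * card (ansB G)) ^ (m - 1)"
  unfolding Val_star_def[of "repeated_game m _"]
proof (rule cSup_least)
  let ?R = "concat_game X' M G Y' P"
  note V0 = Val_star_nonneg[OF finite_plain_game[OF G]]
  note Rm = finite_repeated_game[OF finite_concat_game[OF G M P], of m]
  fix z assume "z \<in> insert 0 {entangled_value (repeated_game m ?R) \<psi> A B |d \<psi> A B.
    entangled_strategy (repeated_game m ?R) d \<psi> A B}"
  then consider "z = 0" | d \<psi> A B where "z = entangled_value (repeated_game m ?R) \<psi> A B"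
    "entangled_strategy (repeated_game m ?R) d \<psi> A B" by blast
  then show "z \<le> (Val_star (plain G) + \<epsilon>) ^ m +
      \<delta> * (real m - 1) * real (card (ansA G) * card (ansB G)) ^ (m - 1)"
  proof cases
    case 1
    then show ?thesis using V0 assms(1-3) by simp
  next
    case 2
    \<comment> \<open>The state of the strategy being bounded. All substrategies obtained from it by
      conditioning share this state, so fortification is invoked for this \<open>d\<close> and
      \<psi> alone.\<close>
    interpret entangled_state d \<psi> by (rule entangled_strategy_imp_state[OF 2(2)])
    have sub: "entangled_substrategy (repeated_game m ?R) d \<psi> A B"
      using 2(2) by (simp add: entangled_strategy_def)
    show ?thesis
      unfolding 2(1) entangled_value_fun_of_mat[OF Rm sub]
    proof (rule game_value_repeated_concat_le[OF G M P assms(3) V0 _ assms(2) _ _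
          POVM_of_entangled_strategy[OF 2(2)]])
      show "game_value (plain G) F H \<le> Val_star (plain G)"
        if "POVM (questX G) (\<lambda>_. ansA G) F" "POVM (questY G) (\<lambda>_. ansB G) H" for F H
        using entangled_value_le_Val_star[OF finite_plain_game[OF G] entangled_strategy_mat_of_fun, of F H] that
        by (simp add: entangled_value_mat_of_fun)
      show "game_value ?R F H \<le> (Val_star (plain G) + \<epsilon>) *
          measure_pmf.expectation (qdist G) (\<lambda>(x, y). tensor_expect \<psi>
            (mat_of_fun d (\<Sum>a\<in>ansA G. induced M (ansA G) F x a))
            (mat_of_fun d (\<Sum>b\<in>ansB G. induced P (ansB G) H y b))) + \<delta>"
        if "subPOVM X' (\<lambda>x'. (M `` {x'}) \<rightarrow>\<^sub>E ansA G) F" "subPOVM Y' (\<lambda>y'. (P `` {y'}) \<rightarrow>\<^sub>E ansB G) H"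
        for F H
      proof -
        have "entangled_substrategy ?R d \<psi> (\<lambda>q a. mat_of_fun d (F q a)) (\<lambda>q b. mat_of_fun d (H q b))"
          using that by (intro entangled_substrategy_mat_of_fun) simp_all
        from fort[unfolded weakly_fortified_entangled_def, rule_format, OF this]
        show ?thesis unfolding entangled_value_mat_of_fun mat_sum_induced_quantum .
      qed
    qed (use assms(1) in auto)
  qed
qed simp

theorem theorem3p4:
  fixes G :: "('x, 'y, 'a, 'b) game"
    and M :: "('x1 \<times> 'x) set" and P :: "('y1 \<times> 'y) set"
    and X' :: "'x1 set" and Y' :: "'y1 set"
    and \<epsilon> \<delta> \<eta> :: real and m :: nat
  assumes "\<epsilon> \<in> {0..1}" and "\<delta> \<in> {0..1}" and "m \<ge> 1" and "\<eta> \<ge> 0"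
    and "is_game G"
    and "is_bipartite_graph M X' (questX G)" and "is_bipartite_graph P Y' (questY G)"
  shows "(weakly_fortified_classical \<epsilon> \<delta> X' M G Y' P \<and>
            \<delta> * (real m - 1) * real (card (ansA G) * card (ansB G)) ^ (m - 1) \<le> \<eta> \<longrightarrow>
          Val (repeated_game m (concat_game X' M G Y' P)) \<le> (Val (plain G) + \<epsilon>) ^ m + \<eta>) \<and>
         (weakly_fortified_entangled \<epsilon> \<delta> X' M G Y' P \<and>
            \<delta> * (real m - 1) * real (card (ansA G) * card (ansB G)) ^ (m - 1) \<le> \<eta> \<longrightarrow>
          Val_star (repeated_game m (concat_game X' M G Y' P)) \<le> (Val_star (plain G) + \<epsilon>) ^ m + \<eta>)"
proof (intro conjI impI; elim conjE)
  assume "weakly_fortified_classical \<epsilon> \<delta> X' M G Y' P"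
    and "\<delta> * (real m - 1) * real (card (ansA G) * card (ansB G)) ^ (m - 1) \<le> \<eta>"
  then show "Val (repeated_game m (concat_game X' M G Y' P)) \<le> (Val (plain G) + \<epsilon>) ^ m + \<eta>"
    using Val_repeated_concat_le[of \<epsilon> \<delta> m G M X' P Y'] assms by simp
next
  assume "weakly_fortified_entangled \<epsilon> \<delta> X' M G Y' P"
    and "\<delta> * (real m - 1) * real (card (ansA G) * card (ansB G)) ^ (m - 1) \<le> \<eta>"
  then show "Val_star (repeated_game m (concat_game X' M G Y' P)) \<le> (Val_star (plain G) + \<epsilon>) ^ m + \<eta>"
    using Val_star_repeated_concat_le[of \<epsilon> \<delta> m G M X' P Y'] assms by simp
qed

end
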